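(* There exists an absolute constant $C>0$ such that the following holds. Let $L\ge 1$, let $d_1,\dots,d_L\ge 1$ be integers, $d_{L+1}=1$, and let $B_x>0$, $B_{W_1},\dots,B_{W_L}>0$. Put $d=\max(d_1,\dots,d_L)$ and $\beta=B_x\prod_{i=1}^L B_{W_i}$. Then there is $n_0$, depending only on $d$, $L$ and $\beta$, such that for all $n\ge n_0$ the following is true. Let $\sigma_i:\mathbb{R}^{d_{i+1}}\to\mathbb{R}^{d_{i+1}}$ ($i=1,\dots,L-1$) be entry-wise activation operators that are $1$-Lipschitz (in Euclidean norm) with $\sigma_i(0)=0$. Let $\mathcal{A}:\mathbb{R}\to[0,1]$ be $1$-Lipschitz, and let $\phi:[0,1]\to\mathbb{R}$ be concave and $\rho_\phi$-Lipschitz. Let $$\mathcal{F}=\Big\{x\mapsto \mathcal{A}\big(D(x;W_1,\dots,W_L)\big)\ :\ W_i\in\mathbb{R}^{d_{i+1}\times d_i},\ \|W_i\|_2\le B_{W_i}\ \text{for } i=1,\dots,L\Big\},$$ where $D(x;W_1,\dots,W_L)=W_L\,\sigma_{L-1}(W_{L-1}\cdots\sigma_1(W_1x)\cdots)$, and assume that $f\in\mathcal{F}$ implies $1-f\in\mathcal{F}$. Let $\mu$ be a probability distribution on $\mathbb{R}^{d_1}$, let $x_1,\dots,x_n$ be i.i.d. samples from $\mu$ with $\|x_i\|_2\le B_x$ for all $i\in\{1,\dots,n\}$ (almost surely), and let $\hat\mu_n$ be their empirical distribution. Let $\mathcal{D}_G$ be the class of distributions on $\mathbb{R}^{d_1}$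 generated by the generators, let $\epsilon\ge 0$, and let $\nu_n\in\mathcal{D}_G$ (depending on the sample) satisfy $$d_{\mathcal{F},\phi}(\hat\mu_n,\nu_n)\le \inf_{\nu\in\mathcal{D}_G} d_{\mathcal{F},\phi}(\hat\mu_n,\nu)+\epsilon .$$ Then for every $\delta\in(0,1)$, with probability at least $1-\delta$ over the joint distribution of $x_1,\dots,x_n$, $$d_{\mathcal{F},\phi}(\mu,\nu_n)\le \inf_{\nu\in\mathcal{D}_G} d_{\mathcal{F},\phi}(\mu,\nu)+C\left(\frac{\rho_\phi\,\beta\sqrt{d^2L\,\log\!\big(\sqrt{dn}\,L\,\beta\big)}}{\sqrt{n}}+\rho_\phi\,\beta\sqrt{\frac{\log\frac1\delta}{n}}\right)+\epsilon .$$
   Context: For a vector, $\|\cdot\|_2$ is the Euclidean norm; for a matrix $M$, $\|M\|_2$ is the spectral norm (largest singular value). $\mathcal{F}$-distance: for a class $\mathcal{F}$ of functions from $\mathbb{R}^{d_1}$ to $[0,1]$ such that $f\in\mathcal{F}$ implies $1-f\in\mathcal{F}$, a concave function $\phi$, and probability distributions $\mu,\nu$ on $\mathbb{R}^{d_1}$, $$d_{\mathcal{F},\phi}(\mu,\nu)=\sup_{f\in\mathcal{F}}\Big(\mathbb{E}_{x\sim\mu}[\phi(f(x))]+\mathbb{E}_{x\sim\nu}[\phi(1-f(x))]\Big)-2\phi(1/2).$$ $D(\cdot\,;W_1,\dots,W_L)$ is the $L$-layer discriminator network of a GAN; an entry-wise activation operator applies a scalar function to each coordinate. For $L=1$ there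 are no activations and $D(x;W_1)=W_1x$. Generators: there is a parametrized family of generators $G_\theta$; $\mathcal{D}_{G_\theta}$ denotes the probability distribution on $\mathbb{R}^{d_1}$ of samples generated by $G_\theta$, and $\mathcal{D}_G=\{\mathcal{D}_{G_\theta}\}_\theta$. No assumption is made on this class beyond its being a nonempty set of probability distributions on $\mathbb{R}^{d_1}$. *)

theory Defs
  imports "HOL-Probability.Probability" "Jordan_Normal_Form.Char_Poly"
begin

text \<open>The layer widths and the number of layers are quantified inside the statement, so vectors and
  matrices are those of \<^theory>\<open>Jordan_Normal_Form.Matrix\<close>, with \<open>carrier_vec m\<close> in the role of
  \<open>\<real>\<close> to the power \<open>m\<close>.\<close>

definition vnorm :: "real Matrix.vec \<Rightarrow> real" where
  "vnorm v = L2_set (vec_index v) {..<dim_vec v}"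

text \<open>The largest singular value. The eigenvalues of \<open>M\<^sup>T M\<close> are the squares of the singular values of
  \<open>M\<close>, up to additional zeros when \<open>M\<close> has more columns than rows; these do not affect the maximum.\<close>

definition spectral_norm :: "real Matrix.mat \<Rightarrow> real" where
  "spectral_norm M = Max {s. 0 \<le> s \<and> eigenvalue (transpose_mat M * M) (s\<^sup>2)}"

text \<open>The Borel sets of \<open>carrier_vec m\<close>, generated by the coordinates.\<close>

definition borel_vec :: "nat \<Rightarrow> real Matrix.vec measure" where
  "borel_vec m = vimage_algebra (carrier_vec m) (\<lambda>v. \<lambda>i\<in>{..<m}. vec_index v i) (\<Pi>\<^sub>M i\<in>{..<m}. borel)"

definition entrywise :: "nat \<Rightarrow> (real Matrix.vec \<Rightarrow> real Matrix.vec) \<Rightarrow> bool" where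
  "entrywise m \<sigma> \<longleftrightarrow> (\<exists>a. \<forall>v\<in>carrier_vec m. \<sigma> v = map_vec a v)"

definition activation :: "nat \<Rightarrow> (real Matrix.vec \<Rightarrow> real Matrix.vec) \<Rightarrow> bool" where
  "activation m \<sigma> \<longleftrightarrow>
     entrywise m \<sigma> \<and>
     (\<forall>u\<in>carrier_vec m. \<forall>v\<in>carrier_vec m. vnorm (\<sigma> u - \<sigma> v) \<le> vnorm (u - v)) \<and>
     \<sigma> (0\<^sub>v m) = 0\<^sub>v m"

text \<open>Layers are numbered from 1. The last one has no activation and takes values in \<open>carrier_vec 1\<close>,
  which is identified with the reals by taking the only entry.\<close>

primrec hidden_layer ::
  "(nat \<Rightarrow> real Matrix.vec \<Rightarrow> real Matrix.vec) \<Rightarrow> (nat \<Rightarrow> real Matrix.mat) \<Rightarrow> nat \<Rightarrow> real Matrix.vec \<Rightarrow> real Matrix.vec"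
where
  "hidden_layer \<sigma> W 0 x = x"
| "hidden_layer \<sigma> W (Suc i) x = \<sigma> (Suc i) (W (Suc i) *\<^sub>v hidden_layer \<sigma> W i x)"

definition discriminator ::
  "(nat \<Rightarrow> real Matrix.vec \<Rightarrow> real Matrix.vec) \<Rightarrow> nat \<Rightarrow> (nat \<Rightarrow> real Matrix.mat) \<Rightarrow> real Matrix.vec \<Rightarrow> real"
where
  "discriminator \<sigma> L W x = vec_index (W L *\<^sub>v hidden_layer \<sigma> W (L - 1) x) 0"

text \<open>Members of the class are restricted to \<open>carrier_vec (d 1)\<close>, so that their values at vectors of
  the wrong dimension play no role in equations between them, in particular in the closure under
  \<open>f \<mapsto> 1 - f\<close>.\<close>

definition discriminator_class ::
  "(real \<Rightarrow> real) \<Rightarrow> (nat \<Rightarrow> real Matrix.vec \<Rightarrow> real Matrix.vec) \<Rightarrow> nat \<Rightarrow> (nat \<Rightarrow> nat) \<Rightarrow> (nat \<Rightarrow> real)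
     \<Rightarrow> (real Matrix.vec \<Rightarrow> real) set"
where
  "discriminator_class A \<sigma> L d BW =
     {\<lambda>x\<in>carrier_vec (d 1). A (discriminator \<sigma> L W x) | W.
        \<forall>i\<in>{1..L}. W i \<in> carrier_mat (d (i + 1)) (d i) \<and> spectral_norm (W i) \<le> BW i}"

definition closed_under_complement :: "'a set \<Rightarrow> ('a \<Rightarrow> real) set \<Rightarrow> bool" where
  "closed_under_complement S F \<longleftrightarrow> (\<forall>f\<in>F. (\<lambda>x\<in>S. 1 - f x) \<in> F)"

definition F_distance ::
  "('a \<Rightarrow> real) set \<Rightarrow> (real \<Rightarrow> real) \<Rightarrow> 'a measure \<Rightarrow> 'a measure \<Rightarrow> real"
where
  "F_distance F \<phi> \<mu> \<nu> =
     (SUP f\<in>F. (\<integral>x. \<phi> (f x) \<partial>\<mu>) + (\<integral>x. \<phi> (1 - f x) \<partial>\<nu>)) - 2 * \<phi> (1/2)"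

text \<open>The law of \<open>x i\<close> for an index \<open>i\<close> drawn uniformly from \<open>{1..n}\<close>.\<close>

definition empirical :: "'a measure \<Rightarrow> nat \<Rightarrow> (nat \<Rightarrow> 'a) \<Rightarrow> 'a measure" where
  "empirical N n x = distr (uniform_count_measure {1..n}) N x"

text \<open>\<open>P\<close> need not describe a measurable set: in the statement it involves a minimiser that depends on
  the sample in an arbitrary way. For measurable \<open>P\<close> this is \<open>p \<le> measure M {x \<in> space M. P x}\<close>.\<close>

definition with_prob_at_least :: "'a measure \<Rightarrow> real \<Rightarrow> ('a \<Rightarrow> bool) \<Rightarrow> bool" where
  "with_prob_at_least M p P \<longleftrightarrow> (\<exists>E\<in>sets M. p \<le> measure M E \<and> (\<forall>x\<in>E. P x))"

end

theory Submission imports Defs begin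

text \<open>
  Only the first term of the F-distance involves \<open>\<mu>\<close>, so replacing \<open>\<mu>\<close> by the empirical distribution
  changes the F-distance to every \<open>\<nu>\<close> by at most the uniform deviation of the sample means of
  \<open>\<phi> \<circ> f\<close>, \<open>f \<in> F\<close>, from their expectations, and the excess of an approximate minimiser is at most
  twice this deviation. On the ball of radius \<open>B\<^sub>x\<close> the discriminator takes values in
  \<open>[-\<beta>, \<beta>]\<close>, hence Hoeffding's inequality applies to a single \<open>\<phi> \<circ> f\<close> with range of length
  \<open>2 \<rho> \<beta>\<close>. Rounding each weight of layer \<open>i\<close> to a multiple of \<open>B\<^sub>W\<^sub>i / K\<close> with \<open>K = L d\<^sup>2 n\<close> produces a
  net of at most \<open>(2K + 1)\<close> to the power \<open>L d\<^sup>2\<close> discriminators, and changes the output by at most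
  \<open>\<beta> / n\<close>. A union bound over the net gives the rate directly, without chaining.
\<close>

subsection \<open>The spectral norm as an operator norm\<close>

text \<open>Serves to turn a maximiser of a quadratic form into an eigenvector without derivatives:
  a zero of a positive semidefinite form is a minimum of it, so the linear term in every coordinate
  direction vanishes.\<close>

lemma psd_form_kernel:
  fixes c :: "'i \<Rightarrow> 'i \<Rightarrow> real"
  assumes "finite I" and sym: "\<And>i j. i \<in> I \<Longrightarrow> j \<in> I \<Longrightarrow> c i j = c j i"
    and psd: "\<And>g. 0 \<le> (\<Sum>i\<in>I. \<Sum>j\<in>I. c i j * g i * g j)"
    and f: "(\<Sum>i\<in>I. \<Sum>j\<in>I. c i j * f i * f j) = 0"
    and "k \<in> I"
  shows "(\<Sum>j\<in>I. c k j * f j) = 0"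
proof -
  define B where "B g h = (\<Sum>i\<in>I. \<Sum>j\<in>I. c i j * g i * h j)" for g h
  have B_sym: "B g h = B h g" for g h
    unfolding B_def by (subst sum.swap) (auto intro!: sum.cong simp: sym)
  define e where "e i = (if i = k then 1 else 0 :: real)" for i
  have e: "B e f = (\<Sum>j\<in>I. c k j * f j)"
  proof -
    have "B e f = (\<Sum>i\<in>I. if i = k then (\<Sum>j\<in>I. c k j * f j) else 0)"
      unfolding B_def e_def by (intro sum.cong) auto
    with assms(1,5) show ?thesis by simp
  qed
  \<comment> \<open>Positivity along the line \<open>f + t e\<close> makes the linear coefficient vanish.\<close>
  have quad: "0 \<le> 2 * t * B e f + t\<^sup>2 * B e e" for t
  proof -
    have "0 \<le> B (\<lambda>i. f i + t * e i) (\<lambda>i. f i + t * e i)"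
      unfolding B_def by (rule psd)
    also have "\<dots> = B f f + t * B f e + t * B e f + t\<^sup>2 * B e e"
      unfolding B_def by (simp add: algebra_simps sum.distrib sum_distrib_left power2_eq_square)
    finally show ?thesis
      using f B_sym[of f e] by (simp add: B_def)
  qed
  have Bee: "0 \<le> B e e"
    unfolding B_def by (rule psd)
  \<comment> \<open>The summand 1 keeps the denominator positive when \<open>B e e\<close> vanishes.
    Evaluating \<open>quad\<close> at \<open>- w\<close> leaves
    \<open>- (w\<^sup>2 * (B e e + 2))\<close>, which is nonnegative only for
    \<open>w = 0\<close>.\<close>
  define w where "w = B e f / (B e e + 1)"
  have w: "B e f = w * (B e e + 1)"
    using Bee by (simp add: w_def)
  have "0 \<le> - (w\<^sup>2 * (B e e + 2))"
    using quad[of "- w"] unfolding w by (simp add: algebra_simps power2_eq_square)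
  then have "w = 0"
    using Bee by (simp add: mult_le_0_iff)
  with w have "B e f = 0" by simp
  then show ?thesis using e by simp
qed

text \<open>Vectors are modelled as functions on all of \<open>nat\<close> that vanish from
  \<open>n\<close> on. The sphere is then a closed subset of a product of the compact sets [-1, 1]
  and {0}, and Tychonoff's theorem applies.\<close>

lemma compact_finite_unit_sphere:
  fixes n :: nat
  shows "compact {f :: nat \<Rightarrow> real. (\<forall>i\<ge>n. f i = 0) \<and> (\<Sum>i<n. (f i)\<^sup>2) = 1}" (is "compact ?S")
proof -
  define T where "T i = (if i < n then {-1..1} else {0 :: real})" for i :: nat
  have "compactin (product_topology (\<lambda>i. euclidean) UNIV) (PiE UNIV T)"
    unfolding compactin_PiE by (auto simp: T_def)
  then have T: "compact (PiE UNIV T)"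
    by (simp add: euclidean_product_topology)
  have "closed ((\<lambda>f :: nat \<Rightarrow> real. \<Sum>i<n. (f i)\<^sup>2) -` {1})"
    by (intro closed_vimage continuous_intros) auto
  with T have "compact (PiE UNIV T \<inter> ((\<lambda>f. \<Sum>i<n. (f i)\<^sup>2) -` {1}))"
    by (intro compact_Int_closed)
  moreover have "PiE UNIV T \<inter> ((\<lambda>f. \<Sum>i<n. (f i)\<^sup>2) -` {1}) = ?S"
  proof -
    have "f i \<in> T i" if "f \<in> ?S" for f i
    proof (cases "i < n")
      case True
      have "(f i)\<^sup>2 \<le> (\<Sum>i<n. (f i)\<^sup>2)"
        using True by (intro member_le_sum) auto
      also have "\<dots> = 1\<^sup>2" using that by simp
      finally have "\<bar>f i\<bar> \<le> 1" by (metis abs_one abs_le_square_iff)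
      with True show ?thesis by (auto simp: T_def)
    next
      case False
      with that show ?thesis by (auto simp: T_def)
    qed
    moreover have "f i = 0" if "f \<in> PiE UNIV T" "n \<le> i" for f i
      using that PiE_mem[of f UNIV T i] by (auto simp: T_def)
    ultimately show ?thesis by (auto simp: PiE_iff)
  qed
  ultimately show ?thesis by simp
qed

text \<open>Compactness gives a maximiser \<open>f\<close> of the form \<open>q\<close> on the unit
  sphere. By homogeneity, \<open>q f\<close> times the squared norm minus \<open>q\<close> is
  positive semidefinite, and it vanishes at \<open>f\<close>; \<open>psd_form_kernel\<close> then
  yields the eigenvector equation with \<open>k = q f\<close>.\<close>

lemma symmetric_form_max_eigenvalue:
  fixes a :: "nat \<Rightarrow> nat \<Rightarrow> real"
  assumes n: "0 < n" and sym: "\<And>i j. i < n \<Longrightarrow> j < n \<Longrightarrow> a i j = a j i"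
  obtains f k where "(\<Sum>i<n. (f i)\<^sup>2) = 1" "\<And>i. i < n \<Longrightarrow> (\<Sum>j<n. a i j * f j) = k * f i"
    "\<And>g. (\<Sum>i<n. \<Sum>j<n. a i j * g i * g j) \<le> k * (\<Sum>i<n. (g i)\<^sup>2)"
proof -
  define S where "S = {f :: nat \<Rightarrow> real. (\<forall>i\<ge>n. f i = 0) \<and> (\<Sum>i<n. (f i)\<^sup>2) = 1}"
  define q where "q f = (\<Sum>i<n. \<Sum>j<n. a i j * f i * f j)" for f :: "nat \<Rightarrow> real"
  have "(\<lambda>i. if i = 0 then 1 else 0) \<in> S"
    using n by (auto simp: S_def if_distrib[of "\<lambda>x. x\<^sup>2"] cong: if_cong)
  then have "S \<noteq> {}" by blast
  have coord: "continuous_on S (\<lambda>f. f i)" for i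
    by (rule continuous_on_subset[OF continuous_on_product_coordinates]) simp
  have "continuous_on S q"
    unfolding q_def by (intro continuous_intros coord)
  from continuous_attains_sup[OF compact_finite_unit_sphere[of n, folded S_def] \<open>S \<noteq> {}\<close> this]
  obtain f where f: "f \<in> S" and max: "\<And>g. g \<in> S \<Longrightarrow> q g \<le> q f"
    by auto
  have le: "q g \<le> q f * (\<Sum>i<n. (g i)\<^sup>2)" for g
  proof (cases "(\<Sum>i<n. (g i)\<^sup>2) = 0")
    case True
    then have "\<forall>i<n. g i = 0"
      by (subst (asm) sum_nonneg_eq_0_iff) auto
    with True show ?thesis by (simp add: q_def)
  next
    case False
    define s where "s = sqrt (\<Sum>i<n. (g i)\<^sup>2)"
    have "0 \<le> (\<Sum>i<n. (g i)\<^sup>2)" by (simp add: sum_nonneg)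
    with False have s: "0 < s" "s\<^sup>2 = (\<Sum>i<n. (g i)\<^sup>2)" by (auto simp: s_def)
    have "(\<lambda>i. if i < n then g i / s else 0) \<in> S"
      using s False by (simp add: S_def power_divide flip: sum_divide_distrib)
    from max[OF this] have "q g / s\<^sup>2 \<le> q f"
      by (simp add: q_def sum_divide_distrib power2_eq_square)
    then show ?thesis using s(1) by (simp add: pos_divide_le_eq flip: s(2))
  qed
  define c where "c i j = (if i = j then q f else 0) - a i j" for i j
  have c: "(\<Sum>i<n. \<Sum>j<n. c i j * g i * g j) = q f * (\<Sum>i<n. (g i)\<^sup>2) - q g" for g
  proof -
    have "(\<Sum>i<n. \<Sum>j<n. c i j * g i * g j)
        = (\<Sum>i<n. \<Sum>j<n. if i = j then q f * (g i)\<^sup>2 else 0) - q g"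
      unfolding q_def sum_subtractf[symmetric] c_def
      by (intro sum.cong) (auto simp: algebra_simps power2_eq_square)
    then show ?thesis by (simp add: sum_distrib_left)
  qed
  have "(\<Sum>j<n. c i j * f j) = 0" if "i < n" for i
  proof (rule psd_form_kernel[of "{..<n}" c f i])
    show "0 \<le> (\<Sum>i<n. \<Sum>j<n. c i j * g i * g j)" for g
      using le[of g] by (simp add: c)
    show "(\<Sum>i<n. \<Sum>j<n. c i j * f i * f j) = 0"
      using f unfolding c by (simp add: S_def)
  qed (use that in \<open>auto simp: c_def sym\<close>)
  then have "(\<Sum>j<n. a i j * f j) = q f * f i" if "i < n" for i
    using that by (simp add: c_def left_diff_distrib sum_subtractf if_distrib[of "\<lambda>x. x * _"] cong: if_cong)
  then show ?thesis
  proof (rule that[of f "q f", rotated])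
    show "(\<Sum>i<n. (f i)\<^sup>2) = 1" using f by (simp add: S_def)
    show "(\<Sum>i<n. \<Sum>j<n. a i j * g i * g j) \<le> q f * (\<Sum>i<n. (g i)\<^sup>2)" for g
      using le[of g] unfolding q_def[of g] .
  qed
qed

lemma vnorm_nonneg [simp]: "0 \<le> vnorm v"
  by (simp add: vnorm_def)

lemma vnorm_square: "(vnorm v)\<^sup>2 = (\<Sum>i<dim_vec v. (vec_index v i)\<^sup>2)"
  by (simp add: vnorm_def L2_set_def sum_nonneg)

text \<open>The quadratic form of \<open>transpose_mat M * M\<close> at \<open>v\<close> is the
  squared norm of \<open>M *\<^sub>v v\<close>, hence at most its largest eigenvalue
  \<open>k\<close> times the squared norm of \<open>v\<close>; and \<open>sqrt k\<close> is among
  the numbers maximised in \<open>spectral_norm\<close>. With \<open>0 < c\<close> the unit sphere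
  is nonempty, so \<open>k\<close> exists.\<close>

lemma vnorm_mult_mat_vec_le:
  assumes M: "M \<in> carrier_mat r c" and c: "0 < c" and v: "v \<in> carrier_vec c"
  shows "vnorm (M *\<^sub>v v) \<le> spectral_norm M * vnorm v"
proof -
  define A where "A = transpose_mat M * M"
  have A: "A \<in> carrier_mat c c" using M by (simp add: A_def)
  have A_index: "A $$ (i, j) = (\<Sum>k<r. M $$ (k, i) * M $$ (k, j))" if "i < c" "j < c" for i j
    using M that by (simp add: A_def scalar_prod_def atLeast0LessThan)
  have form: "(\<Sum>i<c. \<Sum>j<c. A $$ (i, j) * g i * g j) = (vnorm (M *\<^sub>v Matrix.vec c g))\<^sup>2" for g
  proof -
    have "(\<Sum>i<c. \<Sum>j<c. A $$ (i, j) * g i * g j)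
        = (\<Sum>i<c. \<Sum>j<c. \<Sum>k<r. (M $$ (k, i) * g i) * (M $$ (k, j) * g j))"
      by (intro sum.cong) (auto simp: A_index sum_distrib_right intro!: sum.cong)
    also have "\<dots> = (\<Sum>k<r. \<Sum>i<c. \<Sum>j<c. (M $$ (k, i) * g i) * (M $$ (k, j) * g j))"
      by (subst sum.swap[of _ _ "{..<r}"], subst sum.swap[of _ "{..<r}"], simp add: sum.swap[of _ "{..<r}"])
    also have "\<dots> = (vnorm (M *\<^sub>v Matrix.vec c g))\<^sup>2"
      unfolding vnorm_square using M
      by (simp add: scalar_prod_def atLeast0LessThan power2_eq_square sum_product)
    finally show ?thesis .
  qed
  obtain f k where f: "(\<Sum>i<c. (f i)\<^sup>2) = 1"
    and eig: "\<And>i. i < c \<Longrightarrow> (\<Sum>j<c. A $$ (i, j) * f j) = k * f i"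
    and le: "\<And>g. (\<Sum>i<c. \<Sum>j<c. A $$ (i, j) * g i * g j) \<le> k * (\<Sum>i<c. (g i)\<^sup>2)"
    by (rule symmetric_form_max_eigenvalue[OF c, of "\<lambda>i j. A $$ (i, j)"])
      (auto simp: A_index mult.commute)
  have "0 \<le> k"
    using le[of f] f form[of f] by (metis mult.right_neutral order_trans zero_le_power2)
  have "eigenvector A (Matrix.vec c f) k"
  proof -
    have "Matrix.vec c f \<noteq> 0\<^sub>v c"
    proof
      assume "Matrix.vec c f = 0\<^sub>v c"
      then have "f i = 0" if "i < c" for i
        using that by (metis index_vec index_zero_vec(1))
      with f show False by simp
    qed
    moreover have "A *\<^sub>v Matrix.vec c f = k \<cdot>\<^sub>v Matrix.vec c f"
      using A eig by (intro eq_vecI) (auto simp: scalar_prod_def atLeast0LessThan)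
    ultimately show ?thesis using A by (simp add: eigenvector_def)
  qed
  then have k: "eigenvalue A ((sqrt k)\<^sup>2)"
    using \<open>0 \<le> k\<close> by (auto simp: eigenvalue_def)
  \<comment> \<open>\<open>Max\<close> is meaningful only on a finite set. The squares of the
    elements are roots of the characteristic polynomial, and squaring is injective on nonnegative
    reals.\<close>
  have fin: "finite {s. 0 \<le> s \<and> eigenvalue A (s\<^sup>2)}"
  proof (rule finite_imageD)
    show "inj_on (\<lambda>s. s\<^sup>2) {s. 0 \<le> s \<and> eigenvalue A (s\<^sup>2)}"
      by (auto intro!: inj_onI simp: power2_eq_iff_nonneg)
    have "char_poly A \<noteq> 0"
      using degree_monic_char_poly[OF A] by auto
    then have "finite {k. poly (char_poly A) k = 0}"
      by (rule poly_roots_finite)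
    then show "finite ((\<lambda>s. s\<^sup>2) ` {s. 0 \<le> s \<and> eigenvalue A (s\<^sup>2)})"
      by (rule finite_subset[rotated]) (auto simp: eigenvalue_root_char_poly[OF A])
  qed
  have "sqrt k \<le> spectral_norm M"
    unfolding spectral_norm_def A_def[symmetric] using fin k \<open>0 \<le> k\<close> by (intro Max_ge) auto
  have v_eq: "Matrix.vec c (vec_index v) = v" using v by auto
  have "(vnorm (M *\<^sub>v v))\<^sup>2 \<le> k * (vnorm v)\<^sup>2"
    using le[of "vec_index v"] v by (simp add: form v_eq vnorm_square)
  also have "\<dots> = (sqrt k * vnorm v)\<^sup>2"
    using \<open>0 \<le> k\<close> by (simp add: power_mult_distrib)
  finally have "vnorm (M *\<^sub>v v) \<le> sqrt k * vnorm v"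
    by (rule power2_le_imp_le) (simp add: \<open>0 \<le> k\<close>)
  also have "\<dots> \<le> spectral_norm M * vnorm v"
    using \<open>sqrt k \<le> _\<close> by (intro mult_right_mono) auto
  finally show ?thesis .
qed

subsection \<open>Perturbation bounds for networks\<close>

lemma vnorm_triangle:
  assumes "u \<in> carrier_vec m" "v \<in> carrier_vec m"
  shows "vnorm (u + v) \<le> vnorm u + vnorm v"
  using L2_set_triangle_ineq[of "vec_index u" "vec_index v" "{..<m}"] assms
  by (auto simp: vnorm_def cong: L2_set_cong_simp)

lemma abs_index_le_vnorm: "i < dim_vec v \<Longrightarrow> \<bar>vec_index v i\<bar> \<le> vnorm v"
  using member_le_L2_set[of "{..<dim_vec v}" i "\<lambda>i. \<bar>vec_index v i\<bar>"]
  by (simp add: vnorm_def L2_set_def)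

lemma vnorm_le_sum_abs: "vnorm v \<le> (\<Sum>i<dim_vec v. \<bar>vec_index v i\<bar>)"
  unfolding vnorm_def by (rule L2_set_le_sum_abs)

lemma vnorm_carrier_vec_1: "v \<in> carrier_vec 1 \<Longrightarrow> vnorm v = \<bar>vec_index v 0\<bar>"
  by (simp add: vnorm_def L2_set_def)

text \<open>An entry is a coordinate of the image of a unit vector. This confines every weight of
  layer i to \<open>[-BW i, BW i]\<close>, so that finitely many grid cells cover them.\<close>

lemma abs_index_mat_le_spectral_norm:
  assumes M: "M \<in> carrier_mat r c" and "i < r" "j < c"
  shows "\<bar>M $$ (i, j)\<bar> \<le> spectral_norm M"
proof -
  have "M $$ (i, j) = vec_index (M *\<^sub>v unit_vec c j) i"
    using assms by simp
  also have "\<bar>\<dots>\<bar> \<le> vnorm (M *\<^sub>v unit_vec c j)"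
    using assms by (intro abs_index_le_vnorm) auto
  also have "\<dots> \<le> spectral_norm M * vnorm (unit_vec c j :: real Matrix.vec)"
    using assms by (intro vnorm_mult_mat_vec_le) auto
  also have "vnorm (unit_vec c j :: real Matrix.vec) = 1"
  proof -
    have "(vnorm (unit_vec c j :: real Matrix.vec))\<^sup>2 = (\<Sum>i<c. if i = j then 1 else 0)"
      unfolding vnorm_square by (intro sum.cong) (auto simp: unit_vec_def)
    then show ?thesis
      using assms by (simp add: power2_eq_1_iff) (metis neg_0_le_iff_le not_one_le_zero vnorm_nonneg)
  qed
  finally show ?thesis by simp
qed

text \<open>Passing through the sum of absolute values is wasteful, but it takes only a bound on the
  entries, which is what rounding the weights controls.\<close>

lemma vnorm_mult_mat_vec_le_entries:
  assumes M: "M \<in> carrier_mat r c" and v: "v \<in> carrier_vec c"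
    and e: "\<And>i j. i < r \<Longrightarrow> j < c \<Longrightarrow> \<bar>M $$ (i, j)\<bar> \<le> e"
  shows "vnorm (M *\<^sub>v v) \<le> real r * real c * e * vnorm v"
proof -
  have "vnorm (M *\<^sub>v v) \<le> (\<Sum>i<r. \<bar>vec_index (M *\<^sub>v v) i\<bar>)"
    using vnorm_le_sum_abs[of "M *\<^sub>v v"] M by simp
  also have "\<dots> \<le> (\<Sum>i<r. \<Sum>j<c. e * vnorm v)"
  proof (rule sum_mono)
    fix i assume i: "i \<in> {..<r}"
    have "\<bar>vec_index (M *\<^sub>v v) i\<bar> = \<bar>\<Sum>j<c. M $$ (i, j) * vec_index v j\<bar>"
      using M v i by (simp add: scalar_prod_def atLeast0LessThan)
    also have "\<dots> \<le> (\<Sum>j<c. \<bar>M $$ (i, j) * vec_index v j\<bar>)"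
      by (rule sum_abs)
    also have "\<dots> \<le> (\<Sum>j<c. e * vnorm v)"
    proof (rule sum_mono)
      fix j assume j: "j \<in> {..<c}"
      show "\<bar>M $$ (i, j) * vec_index v j\<bar> \<le> e * vnorm v"
        unfolding abs_mult using e[of i j] i j v abs_index_le_vnorm[of j v]
        by (intro mult_mono) (auto intro: order_trans[OF abs_ge_zero])
    qed
    finally show "\<bar>vec_index (M *\<^sub>v v) i\<bar> \<le> (\<Sum>j<c. e * vnorm v)" .
  qed
  finally show ?thesis by (simp add: mult_ac)
qed

lemma activation_carrier: "activation m \<sigma> \<Longrightarrow> v \<in> carrier_vec m \<Longrightarrow> \<sigma> v \<in> carrier_vec m"
  by (auto simp: activation_def entrywise_def)

lemma activation_vnorm_diff_le:
  "activation m \<sigma> \<Longrightarrow> u \<in> carrier_vec m \<Longrightarrow> v \<in> carrier_vec m \<Longrightarrow>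
    vnorm (\<sigma> u - \<sigma> v) \<le> vnorm (u - v)"
  by (auto simp: activation_def)

lemma activation_vnorm_le:
  assumes "activation m \<sigma>" "v \<in> carrier_vec m"
  shows "vnorm (\<sigma> v) \<le> vnorm v"
proof -
  have "\<sigma> v - \<sigma> (0\<^sub>v m) = \<sigma> v" "v - 0\<^sub>v m = v" "\<sigma> (0\<^sub>v m) = 0\<^sub>v m"
    using assms activation_carrier[OF assms] by (auto simp: activation_def)
  then show ?thesis
    using activation_vnorm_diff_le[OF assms, of "0\<^sub>v m"] by simp
qed

text \<open>Testing on multiples of the first unit vector shows that the scalar function is itself
  1-Lipschitz, hence continuous; measurability of the layers rests on this.\<close>

lemma activation_scalar:
  assumes "activation m \<sigma>" "0 < m"
  obtains a where "\<And>v. v \<in> carrier_vec m \<Longrightarrow> \<sigma> v = map_vec a v" "1-lipschitz_on UNIV a"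
proof -
  from assms obtain a where a: "\<And>v. v \<in> carrier_vec m \<Longrightarrow> \<sigma> v = map_vec a v"
    by (auto simp: activation_def entrywise_def)
  have "1-lipschitz_on UNIV a"
  proof (rule lipschitz_onI)
    fix s t :: real
    define e where "e r = r \<cdot>\<^sub>v unit_vec m 0" for r :: real
    have [simp]: "e r \<in> carrier_vec m" for r by (simp add: e_def)
    have [simp]: "dim_vec (e r) = m" for r by (simp add: e_def)
    have ix: "vec_index (e r) 0 = r" for r using assms by (simp add: e_def)
    have "\<bar>a s - a t\<bar> = \<bar>vec_index (\<sigma> (e s) - \<sigma> (e t)) 0\<bar>"
      using assms by (simp add: a ix)
    also have "\<dots> \<le> vnorm (\<sigma> (e s) - \<sigma> (e t))"
      using assms by (intro abs_index_le_vnorm) (simp add: a)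
    also have "\<dots> \<le> vnorm (e s - e t)"
      using assms by (intro activation_vnorm_diff_le) auto
    also have "\<dots> \<le> (\<Sum>i<m. \<bar>vec_index (e s - e t) i\<bar>)"
      using vnorm_le_sum_abs[of "e s - e t"] by (simp add: e_def)
    also have "\<dots> = (\<Sum>i<m. if i = 0 then \<bar>s - t\<bar> else 0)"
      by (intro sum.cong) (auto simp: e_def unit_vec_def)
    also have "\<dots> = \<bar>s - t\<bar>" using assms by simp
    finally show "dist (a s) (a t) \<le> 1 * dist s t" by (simp add: dist_real_def)
  qed simp
  with a that show ?thesis by blast
qed

section \<open>Measurability of the coordinates and of the norm\<close>

lemma vec_index_measurable:
  assumes "r < m"
  shows "(\<lambda>v. vec_index v r) \<in> borel_measurable (borel_vec m)"
proof -
  have "(\<lambda>v. \<lambda>i\<in>{..<m}. vec_index v i) \<in> borel_vec m \<rightarrow>\<^sub>M (\<Pi>\<^sub>M i\<in>{..<m}. borel)"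
    unfolding borel_vec_def by (rule measurable_vimage_algebra1) (auto simp: space_PiM)
  then have "(\<lambda>v. (\<lambda>i\<in>{..<m}. vec_index v i) r) \<in> borel_measurable (borel_vec m)"
    by (rule measurable_compose[OF _ measurable_component_singleton]) (use assms in auto)
  with assms show ?thesis by simp
qed

lemma space_borel_vec: "space (borel_vec m) = carrier_vec m"
  by (simp add: borel_vec_def)

lemma vnorm_measurable: "vnorm \<in> borel_measurable (borel_vec m)"
proof -
  have "(\<lambda>v. \<Sum>i<m. (vec_index v i)\<^sup>2) \<in> borel_measurable (borel_vec m)"
    by (intro borel_measurable_sum borel_measurable_power vec_index_measurable) simp
  then have "(\<lambda>v. sqrt (\<Sum>i<m. (vec_index v i)\<^sup>2)) \<in> borel_measurable (borel_vec m)"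
    by (rule measurable_compose) (intro borel_measurable_continuous_onI continuous_intros)
  then show ?thesis
    by (rule measurable_cong[THEN iffD2, rotated]) (auto simp: space_borel_vec vnorm_def L2_set_def)
qed

section \<open>Norm and perturbation bounds layer by layer\<close>

locale network =
  fixes L :: nat and d :: "nat \<Rightarrow> nat" and BW :: "nat \<Rightarrow> real"
    and \<sigma> :: "nat \<Rightarrow> real Matrix.vec \<Rightarrow> real Matrix.vec"
  assumes L: "1 \<le> L" and d: "\<And>i. i \<in> {1..L} \<Longrightarrow> 1 \<le> d i" and d_last: "d (L + 1) = 1"
    and BW: "\<And>i. i \<in> {1..L} \<Longrightarrow> 0 < BW i"
    and activation: "\<And>i. i \<in> {1..<L} \<Longrightarrow> activation (d (i + 1)) (\<sigma> i)"
begin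

definition weights :: "(nat \<Rightarrow> real Matrix.mat) set" where
  "weights = {W. \<forall>i\<in>{1..L}. W i \<in> carrier_mat (d (i + 1)) (d i) \<and> spectral_norm (W i) \<le> BW i}"

lemma discriminator_class_eq:
  "discriminator_class A \<sigma> L d BW = (\<lambda>W. \<lambda>x\<in>carrier_vec (d 1). A (discriminator \<sigma> L W x)) ` weights"
  by (auto simp: discriminator_class_def weights_def)

text \<open>The input to the activation of layer \<open>Suc i\<close>. Separating it from the
  activation lets the last layer, which has none, be treated like the hidden ones.\<close>

definition pre_activation :: "(nat \<Rightarrow> real Matrix.mat) \<Rightarrow> nat \<Rightarrow> real Matrix.vec \<Rightarrow> real Matrix.vec" where
  "pre_activation W i x = W (Suc i) *\<^sub>v hidden_layer \<sigma> W i x"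

lemma hidden_layer_Suc: "hidden_layer \<sigma> W (Suc i) x = \<sigma> (Suc i) (pre_activation W i x)"
  by (simp add: pre_activation_def)

lemma discriminator_eq: "discriminator \<sigma> L W x = vec_index (pre_activation W (L - 1) x) 0"
  using L by (simp add: discriminator_def pre_activation_def)

lemma weights_carrier: "W \<in> weights \<Longrightarrow> i < L \<Longrightarrow> W (Suc i) \<in> carrier_mat (d (Suc (Suc i))) (d (Suc i))"
  by (auto simp: weights_def)

lemma hidden_layer_carrier:
  "W \<in> weights \<Longrightarrow> x \<in> carrier_vec (d 1) \<Longrightarrow> i < L \<Longrightarrow> hidden_layer \<sigma> W i x \<in> carrier_vec (d (Suc i))"
proof (induction i)
  case (Suc i)
  then show ?case
    using activation_carrier[OF activation[of "Suc i"]] weights_carrier[of W i] by auto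
qed simp

lemma pre_activation_carrier:
  "W \<in> weights \<Longrightarrow> x \<in> carrier_vec (d 1) \<Longrightarrow> i < L \<Longrightarrow> pre_activation W i x \<in> carrier_vec (d (Suc (Suc i)))"
  using hidden_layer_carrier[of W x i] weights_carrier[of W i] by (simp add: pre_activation_def)

lemma pre_activation_vnorm_le:
  assumes W: "W \<in> weights" and x: "x \<in> carrier_vec (d 1)" and i: "i < L"
  shows "vnorm (pre_activation W i x) \<le> BW (Suc i) * vnorm (hidden_layer \<sigma> W i x)"
proof -
  have "vnorm (pre_activation W i x) \<le> spectral_norm (W (Suc i)) * vnorm (hidden_layer \<sigma> W i x)"
    unfolding pre_activation_def
    using weights_carrier[OF W i] hidden_layer_carrier[OF W x i] d[of "Suc i"] i
    by (intro vnorm_mult_mat_vec_le) auto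
  also have "\<dots> \<le> BW (Suc i) * vnorm (hidden_layer \<sigma> W i x)"
    using W i by (intro mult_right_mono) (auto simp: weights_def)
  finally show ?thesis .
qed

text \<open>Activations are 1-Lipschitz and fix 0, so they do not increase norms, and each matrix
  contributes its spectral bound.\<close>

lemma hidden_layer_vnorm_le:
  assumes W: "W \<in> weights" and x: "x \<in> carrier_vec (d 1)"
  shows "i < L \<Longrightarrow> vnorm (hidden_layer \<sigma> W i x) \<le> vnorm x * (\<Prod>j=1..i. BW j)"
proof (induction i)
  case (Suc i)
  have "vnorm (hidden_layer \<sigma> W (Suc i) x) \<le> vnorm (pre_activation W i x)"
    unfolding hidden_layer_Suc
    using Suc.prems activation_vnorm_le[OF activation[of "Suc i"]] pre_activation_carrier[OF W x, of i] by simp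
  also have "\<dots> \<le> BW (Suc i) * vnorm (hidden_layer \<sigma> W i x)"
    using Suc.prems by (intro pre_activation_vnorm_le W x) auto
  also have "\<dots> \<le> BW (Suc i) * (vnorm x * (\<Prod>j=1..i. BW j))"
    using Suc BW[of "Suc i"] by (intro mult_left_mono) auto
  finally show ?case by (simp add: mult_ac)
qed simp

text \<open>Splitting W h - W' h' as W (h - h') + (W - W') h' separates the error inherited from
  earlier layers, amplified by at most \<open>BW (Suc i)\<close>, from the new error of this layer,
  which is bounded through the entries. Since \<tau> is a precision relative to
  \<open>BW (Suc i)\<close>, this factor comes out of both terms.\<close>

lemma pre_activation_diff_le:
  assumes W: "W \<in> weights" and W': "W' \<in> weights" and x: "x \<in> carrier_vec (d 1)" and i: "i < L"
    and m: "\<And>k. k \<in> {1..L + 1} \<Longrightarrow> d k \<le> m"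
    and diff: "\<And>r c. r < d (Suc (Suc i)) \<Longrightarrow> c < d (Suc i) \<Longrightarrow>
      \<bar>W (Suc i) $$ (r, c) - W' (Suc i) $$ (r, c)\<bar> \<le> \<tau> * BW (Suc i)"
    and "0 \<le> \<tau>"
  shows "vnorm (pre_activation W i x - pre_activation W' i x)
    \<le> BW (Suc i) * (vnorm (hidden_layer \<sigma> W i x - hidden_layer \<sigma> W' i x)
        + (real m)\<^sup>2 * \<tau> * vnorm (hidden_layer \<sigma> W' i x))"
proof -
  let ?h = "hidden_layer \<sigma> W i x" and ?h' = "hidden_layer \<sigma> W' i x"
  let ?V = "W (Suc i)" and ?V' = "W' (Suc i)"
  note V = weights_carrier[OF W i] weights_carrier[OF W' i]
  note h = hidden_layer_carrier[OF W x i] hidden_layer_carrier[OF W' x i]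
  have BWi: "0 < BW (Suc i)" using BW[of "Suc i"] i by simp
  have "pre_activation W i x - pre_activation W' i x = ?V *\<^sub>v (?h - ?h') + (?V - ?V') *\<^sub>v ?h'"
    using V h by (intro eq_vecI)
      (auto simp: pre_activation_def mult_minus_distrib_mat_vec minus_mult_distrib_mat_vec)
  also have "vnorm \<dots> \<le> vnorm (?V *\<^sub>v (?h - ?h')) + vnorm ((?V - ?V') *\<^sub>v ?h')"
    using V h by (intro vnorm_triangle[of _ "d (Suc (Suc i))"] mult_mat_vec_carrier minus_carrier_mat) auto
  also have "vnorm (?V *\<^sub>v (?h - ?h')) \<le> spectral_norm ?V * vnorm (?h - ?h')"
    using V h d[of "Suc i"] i by (intro vnorm_mult_mat_vec_le) auto
  also have "\<dots> \<le> BW (Suc i) * vnorm (?h - ?h')"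
    using W i by (intro mult_right_mono) (auto simp: weights_def)
  also have "vnorm ((?V - ?V') *\<^sub>v ?h') \<le> real (d (Suc (Suc i))) * real (d (Suc i)) * (\<tau> * BW (Suc i)) * vnorm ?h'"
    using V h diff by (intro vnorm_mult_mat_vec_le_entries) auto
  also have "\<dots> \<le> real m * real m * (\<tau> * BW (Suc i)) * vnorm ?h'"
    using BWi m[of "Suc i"] m[of "Suc (Suc i)"] i \<open>0 \<le> \<tau>\<close> by (intro mult_right_mono mult_mono) auto
  finally show ?thesis by (simp add: algebra_simps power2_eq_square)
qed

text \<open>Each layer adds one further error of m^2 \<tau> times the norm bound of that layer,
  while older errors are only scaled along with the norm bound. The total is therefore linear in
  \<open>i\<close>.\<close>

lemma hidden_layer_diff_le:
  assumes W: "W \<in> weights" and W': "W' \<in> weights" and x: "x \<in> carrier_vec (d 1)"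
    and m: "\<And>k. k \<in> {1..L + 1} \<Longrightarrow> d k \<le> m"
    and diff: "\<And>i r c. i < L \<Longrightarrow> r < d (Suc (Suc i)) \<Longrightarrow> c < d (Suc i) \<Longrightarrow>
      \<bar>W (Suc i) $$ (r, c) - W' (Suc i) $$ (r, c)\<bar> \<le> \<tau> * BW (Suc i)"
    and "0 \<le> \<tau>"
  shows "i < L \<Longrightarrow> vnorm (hidden_layer \<sigma> W i x - hidden_layer \<sigma> W' i x)
    \<le> real i * (real m)\<^sup>2 * \<tau> * (vnorm x * (\<Prod>j=1..i. BW j))"
proof (induction i)
  case 0
  then show ?case by (simp add: vnorm_def L2_set_def)
next
  case (Suc i)
  have BWi: "0 < BW (Suc i)" using BW[of "Suc i"] Suc.prems by simp
  have "vnorm (hidden_layer \<sigma> W (Suc i) x - hidden_layer \<sigma> W' (Suc i) x)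
      \<le> vnorm (pre_activation W i x - pre_activation W' i x)"
    unfolding hidden_layer_Suc
    using Suc.prems activation_vnorm_diff_le[OF activation[of "Suc i"]]
      pre_activation_carrier[OF W x, of i] pre_activation_carrier[OF W' x, of i] by simp
  also have "\<dots> \<le> BW (Suc i) * (vnorm (hidden_layer \<sigma> W i x - hidden_layer \<sigma> W' i x)
        + (real m)\<^sup>2 * \<tau> * vnorm (hidden_layer \<sigma> W' i x))"
    using Suc.prems by (intro pre_activation_diff_le W W' x m diff \<open>0 \<le> \<tau>\<close>) auto
  also have "\<dots> \<le> BW (Suc i) * (real i * (real m)\<^sup>2 * \<tau> * (vnorm x * (\<Prod>j=1..i. BW j))
        + (real m)\<^sup>2 * \<tau> * (vnorm x * (\<Prod>j=1..i. BW j)))"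
    using Suc BWi \<open>0 \<le> \<tau>\<close> hidden_layer_vnorm_le[OF W' x, of i]
    by (intro mult_left_mono add_mono) auto
  finally show ?case by (simp add: algebra_simps)
qed

text \<open>Supplies the range for Hoeffding's inequality. The last width is 1, so the norm of the
  output vector is the absolute value of its only entry.\<close>

lemma abs_discriminator_le:
  assumes W: "W \<in> weights" and x: "x \<in> carrier_vec (d 1)"
  shows "\<bar>discriminator \<sigma> L W x\<bar> \<le> vnorm x * (\<Prod>j=1..L. BW j)"
proof -
  obtain l where l: "L = Suc l" using L by (cases L) auto
  have "\<bar>discriminator \<sigma> L W x\<bar> = vnorm (pre_activation W l x)"
    unfolding discriminator_eq using pre_activation_carrier[OF W x, of l] d_last l
    by (simp add: vnorm_carrier_vec_1)
  also have "\<dots> \<le> BW (Suc l) * vnorm (hidden_layer \<sigma> W l x)"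
    using l by (intro pre_activation_vnorm_le W x) auto
  also have "\<dots> \<le> BW (Suc l) * (vnorm x * (\<Prod>j=1..l. BW j))"
    using BW[of "Suc l"] l by (intro mult_left_mono hidden_layer_vnorm_le W x) auto
  finally show ?thesis by (simp add: l mult_ac)
qed

text \<open>The factor \<open>m\<^sup>2\<close> is crude (\<open>m\<close> would do), but it enters the final rate only through a logarithm.\<close>

lemma abs_discriminator_diff_le:
  assumes W: "W \<in> weights" and W': "W' \<in> weights" and x: "x \<in> carrier_vec (d 1)"
    and m: "\<And>k. k \<in> {1..L + 1} \<Longrightarrow> d k \<le> m"
    and diff: "\<And>i r c. i < L \<Longrightarrow> r < d (Suc (Suc i)) \<Longrightarrow> c < d (Suc i) \<Longrightarrow>
      \<bar>W (Suc i) $$ (r, c) - W' (Suc i) $$ (r, c)\<bar> \<le> \<tau> * BW (Suc i)"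
    and "0 \<le> \<tau>"
  shows "\<bar>discriminator \<sigma> L W x - discriminator \<sigma> L W' x\<bar>
    \<le> real L * (real m)\<^sup>2 * \<tau> * (vnorm x * (\<Prod>j=1..L. BW j))"
proof -
  obtain l where l: "L = Suc l" using L by (cases L) auto
  have BWl: "0 < BW (Suc l)" using BW[of "Suc l"] l by simp
  have "\<bar>discriminator \<sigma> L W x - discriminator \<sigma> L W' x\<bar>
      = vnorm (pre_activation W l x - pre_activation W' l x)"
    unfolding discriminator_eq
    using pre_activation_carrier[OF W x, of l] pre_activation_carrier[OF W' x, of l] d_last l
    by (simp add: vnorm_carrier_vec_1)
  also have "\<dots> \<le> BW (Suc l) * (vnorm (hidden_layer \<sigma> W l x - hidden_layer \<sigma> W' l x)
        + (real m)\<^sup>2 * \<tau> * vnorm (hidden_layer \<sigma> W' l x))"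
    using l by (intro pre_activation_diff_le W W' x m diff \<open>0 \<le> \<tau>\<close>) auto
  also have "\<dots> \<le> BW (Suc l) * (real l * (real m)\<^sup>2 * \<tau> * (vnorm x * (\<Prod>j=1..l. BW j))
        + (real m)\<^sup>2 * \<tau> * (vnorm x * (\<Prod>j=1..l. BW j)))"
    using BWl l \<open>0 \<le> \<tau>\<close>
    by (intro mult_left_mono add_mono hidden_layer_vnorm_le hidden_layer_diff_le W W' x m diff) auto
  finally show ?thesis by (simp add: l algebra_simps)
qed

section \<open>Measurability of the discriminator\<close>

lemma hidden_layer_measurable:
  assumes W: "W \<in> weights"
  shows "i < L \<Longrightarrow> r < d (Suc i) \<Longrightarrow>
    (\<lambda>x. vec_index (hidden_layer \<sigma> W i x) r) \<in> borel_measurable (borel_vec (d 1))"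
    and pre_activation_measurable: "i < L \<Longrightarrow> r < d (Suc (Suc i)) \<Longrightarrow>
    (\<lambda>x. vec_index (pre_activation W i x) r) \<in> borel_measurable (borel_vec (d 1))"
proof -
  \<comment> \<open>The two claims alternate along the layers, so the passage from a hidden layer to
    the next pre-activation is isolated here, with the former as a premise, for use inside the
    induction.\<close>
  have step: "(\<lambda>x. vec_index (pre_activation W i x) r) \<in> borel_measurable (borel_vec (d 1))"
    if i: "i < L" "r < d (Suc (Suc i))" and h: "\<And>r. r < d (Suc i) \<Longrightarrow>
      (\<lambda>x. vec_index (hidden_layer \<sigma> W i x) r) \<in> borel_measurable (borel_vec (d 1))" for i r
  proof -
    have eq: "vec_index (pre_activation W i x) r
        = (\<Sum>j<d (Suc i). W (Suc i) $$ (r, j) * vec_index (hidden_layer \<sigma> W i x) j)"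
      if "x \<in> space (borel_vec (d 1))" for x
      using hidden_layer_carrier[OF W, of x i] weights_carrier[OF W, of i] that i
      by (simp add: pre_activation_def scalar_prod_def atLeast0LessThan space_borel_vec)
    have "(\<lambda>x. \<Sum>j<d (Suc i). W (Suc i) $$ (r, j) * vec_index (hidden_layer \<sigma> W i x) j)
        \<in> borel_measurable (borel_vec (d 1))"
      using h by (intro borel_measurable_sum borel_measurable_times) auto
    then show ?thesis
      by (rule measurable_cong[THEN iffD2, rotated]) (rule eq)
  qed
  have hidden: "i < L \<Longrightarrow> r < d (Suc i) \<Longrightarrow>
    (\<lambda>x. vec_index (hidden_layer \<sigma> W i x) r) \<in> borel_measurable (borel_vec (d 1))" for i r
  proof (induction i arbitrary: r)
    case 0
    then show ?case by (simp add: vec_index_measurable)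
  next
    case (Suc i)
    have "0 < d (Suc (Suc i))" using d[of "Suc (Suc i)"] Suc.prems by simp
    with Suc.prems obtain a
      where a: "\<And>v. v \<in> carrier_vec (d (Suc (Suc i))) \<Longrightarrow> \<sigma> (Suc i) v = map_vec a v"
        and lip: "1-lipschitz_on UNIV a"
      using activation_scalar[OF activation[of "Suc i"]] by auto
    have eq: "vec_index (hidden_layer \<sigma> W (Suc i) x) r = a (vec_index (pre_activation W i x) r)"
      if "x \<in> space (borel_vec (d 1))" for x
      using that Suc.prems pre_activation_carrier[OF W, of x i]
      by (simp add: hidden_layer_Suc a space_borel_vec del: hidden_layer.simps)
    have [measurable]: "a \<in> borel_measurable borel"
      using lip by (intro borel_measurable_continuous_onI lipschitz_on_continuous_on)
    have [measurable]: "(\<lambda>x. vec_index (pre_activation W i x) r) \<in> borel_measurable (borel_vec (d 1))"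
      using Suc by (intro step) auto
    have "(\<lambda>x. a (vec_index (pre_activation W i x) r)) \<in> borel_measurable (borel_vec (d 1))"
      by measurable
    then show ?case
      by (rule measurable_cong[THEN iffD2, rotated]) (rule eq)
  qed
  show "i < L \<Longrightarrow> r < d (Suc i) \<Longrightarrow>
    (\<lambda>x. vec_index (hidden_layer \<sigma> W i x) r) \<in> borel_measurable (borel_vec (d 1))"
    by (rule hidden)
  show "i < L \<Longrightarrow> r < d (Suc (Suc i)) \<Longrightarrow>
    (\<lambda>x. vec_index (pre_activation W i x) r) \<in> borel_measurable (borel_vec (d 1))"
    by (rule step) (use hidden in auto)
qed

lemma discriminator_measurable:
  "W \<in> weights \<Longrightarrow> discriminator \<sigma> L W \<in> borel_measurable (borel_vec (d 1))"
  using pre_activation_measurable[of W "L - 1" 0] L d_last by (simp add: discriminator_eq[abs_def])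

end

subsection \<open>Covering and concentration\<close>

text \<open>One member is picked from each nonempty fibre of \<open>q\<close>. The net then lies in
  \<open>T\<close> itself, which matters because rounded weights may violate the spectral norm
  bounds.\<close>

lemma finite_representatives:
  assumes "finite Q" "q ` T \<subseteq> Q"
  obtains R where "R \<subseteq> T" "finite R" "card R \<le> card Q" "\<And>t. t \<in> T \<Longrightarrow> \<exists>r\<in>R. q r = q t"
proof
  define rep where "rep c = (SOME t. t \<in> T \<and> q t = c)" for c
  have rep: "rep (q t) \<in> T \<and> q (rep (q t)) = q t" if "t \<in> T" for t
    unfolding rep_def by (rule someI[of _ t]) (use that in simp)
  show "rep ` q ` T \<subseteq> T" using rep by auto
  show "finite (rep ` q ` T)" using assms by (auto dest: finite_subset)
  show "card (rep ` q ` T) \<le> card Q"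
    using assms by (meson card_image_le card_mono finite_subset order_trans)
  show "\<exists>r\<in>rep ` q ` T. q r = q t" if "t \<in> T" for t
    using rep[OF that] that by blast
qed

lemma (in network) weights_cover:
  assumes K: "0 < K" and m: "\<And>k. k \<in> {1..L + 1} \<Longrightarrow> d k \<le> m"
  obtains R where "R \<subseteq> weights" "finite R" "card R \<le> (2 * K + 1) ^ (L * m\<^sup>2)"
    "\<And>W. W \<in> weights \<Longrightarrow> \<exists>V\<in>R. \<forall>i r c. i < L \<longrightarrow> r < d (Suc (Suc i)) \<longrightarrow> c < d (Suc i) \<longrightarrow>
      \<bar>W (Suc i) $$ (r, c) - V (Suc i) $$ (r, c)\<bar> \<le> 1 / real K * BW (Suc i)"
proof -
  define I where "I = {..<L} \<times> {..<m} \<times> {..<m}"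
  \<comment> \<open>The grid cell of each weight, in units of \<open>BW (Suc i) / K\<close>.
    Positions outside the actual matrix get 0, so every layer is padded to m by m and the index set
    \<open>I\<close> has L m^2 elements.\<close>
  define cell where "cell W = (\<lambda>(i, r, c). if r < d (Suc (Suc i)) \<and> c < d (Suc i)
    then \<lfloor>W (Suc i) $$ (r, c) * real K / BW (Suc i)\<rfloor> else 0)" for W :: "nat \<Rightarrow> real Matrix.mat"
  define q where "q W = restrict (cell W) I" for W
  define Q where "Q = (\<Pi>\<^sub>E x\<in>I. {- int K..int K})"
  have card_Q: "card Q = (2 * K + 1) ^ (L * m\<^sup>2)"
  proof -
    have "card Q = (\<Prod>x\<in>I. card {- int K..int K})"
      unfolding Q_def by (intro card_PiE) (simp add: I_def)
    then show ?thesis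
      by (simp add: I_def power2_eq_square nat_add_distrib nat_mult_distrib)
  qed
  have fin_Q: "finite Q" unfolding Q_def by (intro finite_PiE) (auto simp: I_def)
  have cell: "cell W (i, r, c) \<in> {- int K..int K}" if W: "W \<in> weights" and i: "i < L" for W i r c
  proof (cases "r < d (Suc (Suc i)) \<and> c < d (Suc i)")
    case True
    have B: "0 < BW (Suc i)" using BW[of "Suc i"] i by simp
    have "\<bar>W (Suc i) $$ (r, c)\<bar> \<le> spectral_norm (W (Suc i))"
      using True by (intro abs_index_mat_le_spectral_norm[OF weights_carrier[OF W i]]) auto
    also have "\<dots> \<le> BW (Suc i)" using W i by (auto simp: weights_def)
    finally have "\<bar>W (Suc i) $$ (r, c) * real K / BW (Suc i)\<bar> \<le> real K"
      using B by (simp add: abs_mult pos_divide_le_eq mult_left_mono mult.commute)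
    then have "- real K \<le> W (Suc i) $$ (r, c) * real K / BW (Suc i)"
      "W (Suc i) $$ (r, c) * real K / BW (Suc i) \<le> real K" by linarith+
    then show ?thesis
      using True by (simp add: cell_def le_floor_iff floor_le_iff)
  qed (auto simp: cell_def)
  have "q ` weights \<subseteq> Q"
  proof (rule image_subsetI)
    fix W assume "W \<in> weights"
    then show "q W \<in> Q"
      unfolding q_def Q_def restrict_PiE_iff by (auto simp: I_def simp del: atLeastAtMost_iff intro: cell)
  qed
  then obtain R where R: "R \<subseteq> weights" "finite R" "card R \<le> card Q"
    and rep: "\<And>W. W \<in> weights \<Longrightarrow> \<exists>V\<in>R. q V = q W"
    by (rule finite_representatives[OF fin_Q]) (rule that)
  have close: "\<bar>W (Suc i) $$ (r, c) - V (Suc i) $$ (r, c)\<bar> \<le> 1 / real K * BW (Suc i)"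
    if eq: "q V = q W" and i: "i < L" and r: "r < d (Suc (Suc i))" and c: "c < d (Suc i)" for V W i r c
  proof -
    have B: "0 < BW (Suc i)" using BW[of "Suc i"] i by simp
    have "(i, r, c) \<in> I" using i r c m[of "Suc i"] m[of "Suc (Suc i)"] by (auto simp: I_def)
    with eq have "cell V (i, r, c) = cell W (i, r, c)"
      unfolding q_def by (metis restrict_apply')
    \<comment> \<open>Two reals with the same floor differ by less than 1.\<close>
    then have "\<bar>W (Suc i) $$ (r, c) * real K / BW (Suc i) - V (Suc i) $$ (r, c) * real K / BW (Suc i)\<bar> \<le> 1"
      using r c unfolding cell_def by (simp; linarith)
    then have "\<bar>W (Suc i) $$ (r, c) - V (Suc i) $$ (r, c)\<bar> * (real K / BW (Suc i)) \<le> 1"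
      using B by (simp add: abs_mult flip: diff_divide_distrib left_diff_distrib)
    then show ?thesis using B K by (simp add: field_simps)
  qed
  show ?thesis
  proof (rule that)
    show "card R \<le> (2 * K + 1) ^ (L * m\<^sup>2)" using R(3) by (simp add: card_Q)
    fix W assume "W \<in> weights"
    then obtain V where "V \<in> R" "q V = q W" using rep by blast
    with close show "\<exists>V\<in>R. \<forall>i r c. i < L \<longrightarrow> r < d (Suc (Suc i)) \<longrightarrow> c < d (Suc i) \<longrightarrow>
      \<bar>W (Suc i) $$ (r, c) - V (Suc i) $$ (r, c)\<bar> \<le> 1 / real K * BW (Suc i)"
      by (intro bexI[of _ V] allI impI) auto
  qed (fact R)+
qed

section \<open>Concentration of sample means\<close>

lemma indep_vars_PiM_coordinates:
  assumes "prob_space N" "I \<noteq> {}"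
  shows "prob_space.indep_vars (\<Pi>\<^sub>M i\<in>I. N) (\<lambda>_. N) (\<lambda>i x. x i) I"
proof -
  interpret N: prob_space N by fact
  interpret prob_space "\<Pi>\<^sub>M i\<in>I. N" by (intro prob_space_PiM assms(1))
  have "distr (\<Pi>\<^sub>M i\<in>I. N) (\<Pi>\<^sub>M i\<in>I. N) (\<lambda>x. \<lambda>i\<in>I. x i) = (\<Pi>\<^sub>M i\<in>I. N)"
  proof -
    have "distr (\<Pi>\<^sub>M i\<in>I. N) (\<Pi>\<^sub>M i\<in>I. N) (\<lambda>x. \<lambda>i\<in>I. x i) = distr (\<Pi>\<^sub>M i\<in>I. N) (\<Pi>\<^sub>M i\<in>I. N) (\<lambda>x. x)"
      by (intro distr_cong refl) (simp add: space_PiM PiE_restrict)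
    then show ?thesis by simp
  qed
  moreover have "(\<Pi>\<^sub>M i\<in>I. distr (\<Pi>\<^sub>M i\<in>I. N) N (\<lambda>x. x i)) = (\<Pi>\<^sub>M i\<in>I. N)"
    using assms by (intro PiM_cong refl distr_PiM_component)
  ultimately show ?thesis
    using \<open>I \<noteq> {}\<close> by (subst indep_vars_iff_distr_eq_PiM') auto
qed

text \<open>Under the product measure the coordinates are independent with law \<open>N\<close>, so
  Hoeffding's inequality for i.i.d. variables applies to \<open>g (x i)\<close>, with the integral
  of \<open>g\<close> over \<open>N\<close> as the common mean.\<close>

lemma Hoeffding_sample_mean:
  fixes g :: "'a \<Rightarrow> real"
  assumes N: "prob_space N" and g [measurable]: "g \<in> borel_measurable N"
    and ran: "AE x in N. g x \<in> {a..b}" and "a < b" "0 < n" "0 \<le> t"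
  defines "M \<equiv> \<Pi>\<^sub>M i\<in>{1..n::nat}. N"
  shows "measure M {x\<in>space M. t \<le> \<bar>(\<Sum>i=1..n. g (x i)) / n - (\<integral>x. g x \<partial>N)\<bar>}
    \<le> 2 * exp (- 2 * real n * t\<^sup>2 / (b - a)\<^sup>2)"
proof -
  interpret N: prob_space N by fact
  interpret M: prob_space M unfolding M_def by (intro prob_space_PiM N)
  have component: "distr M N (\<lambda>x. x i) = N" if "i \<in> {1..n}" for i
    unfolding M_def using that N by (intro distr_PiM_component) auto
  have meas: "(\<lambda>x. x i) \<in> M \<rightarrow>\<^sub>M N" if "i \<in> {1..n}" for i
    unfolding M_def using that by measurable
  have distr: "distr M borel (\<lambda>x. g (x i)) = distr N borel g" if "i \<in> {1..n}" for i
  proof -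
    have "distr M borel (\<lambda>x. g (x i)) = distr (distr M N (\<lambda>x. x i)) borel g"
      using meas[OF that] by (subst distr_distr) (auto simp: comp_def)
    with component[OF that] show ?thesis by simp
  qed
  have 1: "1 \<in> {1..n}" using \<open>0 < n\<close> by simp
  have mean: "(\<integral>x. g (x 1) \<partial>M) = (\<integral>x. g x \<partial>N)"
    using integral_distr[OF meas[OF 1] g] component[OF 1] by simp
  interpret Hoeffding_ineq_iid M "{1..n}" "\<lambda>i x. g (x i)" "\<lambda>x. g (x 1)" a b "\<integral>x. g x \<partial>N"
  proof unfold_locales
    have "M.indep_vars (\<lambda>_. N) (\<lambda>i x. x i) {1..n}"
      unfolding M_def using \<open>0 < n\<close> by (intro indep_vars_PiM_coordinates N) auto
    then show "M.indep_vars (\<lambda>_. borel) (\<lambda>i x. g (x i)) {1..n}"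
      by (rule M.indep_vars_compose2) (rule g)
    show "distr M borel (\<lambda>x. g (x i)) = distr M borel (\<lambda>x. g (x 1))" if "i \<in> {1..n}" for i
      by (rule trans[OF distr[OF that] distr[OF 1, symmetric]])
    show "(\<lambda>x. g (x 1)) \<in> borel_measurable M"
      by (rule measurable_compose[OF meas[OF 1] g])
    show "AE x in M. g (x 1) \<in> {a..b}"
      using AE_PiM_component[of "{1..n}" "\<lambda>_. N" 1, OF N 1 ran] unfolding M_def .
    show "(\<integral>x. g x \<partial>N) \<equiv> (\<integral>x. g (x 1) \<partial>M)"
      by (rule eq_reflection) (rule mean[symmetric])
  qed simp
  show ?thesis
    using Hoeffding_ineq_abs_ge'[OF \<open>0 \<le> t\<close> \<open>a < b\<close>] \<open>0 < n\<close> by simp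
qed

lemma sum_coordinates_measurable:
  fixes g :: "'a \<Rightarrow> real"
  assumes [measurable]: "g \<in> borel_measurable N"
  shows "(\<lambda>x. \<Sum>i\<in>I. g (x i)) \<in> borel_measurable (\<Pi>\<^sub>M i\<in>I. N)"
  by measurable

lemma uniform_deviation_event:
  fixes g :: "'i \<Rightarrow> 'a \<Rightarrow> real" and c :: "'i \<Rightarrow> real" and n :: nat
  assumes g: "\<And>v. v \<in> R \<Longrightarrow> g v \<in> borel_measurable N" and "finite R"
  defines "M \<equiv> \<Pi>\<^sub>M i\<in>{1..n}. N"
  shows "{x\<in>space M. \<forall>v\<in>R. \<bar>(\<Sum>i=1..n. g v (x i)) / n - c v\<bar> \<le> t} \<in> sets M"
proof (rule sets.sets_Collect_finite_All[OF _ \<open>finite R\<close>])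
  fix v assume "v \<in> R"
  define T where "T x = (\<Sum>i=1..n. g v (x i))" for x
  have [measurable]: "T \<in> borel_measurable M"
    unfolding M_def T_def[abs_def] using g[OF \<open>v \<in> R\<close>] by (rule sum_coordinates_measurable)
  show "{x\<in>space M. \<bar>(\<Sum>i=1..n. g v (x i)) / n - c v\<bar> \<le> t} \<in> sets M"
    unfolding T_def[symmetric] by measurable
qed

text \<open>A union bound over \<open>R\<close>. The bad events include a deviation of exactly
  \<open>t\<close>, as in Hoeffding's inequality, so the complement of their union lies inside the
  event with \<open>\<le> t\<close>.\<close>

lemma Hoeffding_sample_mean_uniform:
  fixes g :: "'i \<Rightarrow> 'a \<Rightarrow> real"
  assumes N: "prob_space N" and g: "\<And>v. v \<in> R \<Longrightarrow> g v \<in> borel_measurable N"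
    and ran: "\<And>v. v \<in> R \<Longrightarrow> AE x in N. g v x \<in> {a..b}" and "a < b" "0 < n" "0 \<le> t" "finite R"
  defines "M \<equiv> \<Pi>\<^sub>M i\<in>{1..n::nat}. N"
  shows "1 - real (card R) * (2 * exp (- 2 * real n * t\<^sup>2 / (b - a)\<^sup>2))
    \<le> measure M {x\<in>space M. \<forall>v\<in>R. \<bar>(\<Sum>i=1..n. g v (x i)) / n - (\<integral>x. g v x \<partial>N)\<bar> \<le> t}"
proof -
  interpret M: prob_space M unfolding M_def by (intro prob_space_PiM N)
  define bad where "bad v = {x\<in>space M. t \<le> \<bar>(\<Sum>i=1..n. g v (x i)) / n - (\<integral>x. g v x \<partial>N)\<bar>}" for v
  have sum_meas: "(\<lambda>x. \<Sum>i=1..n. g v (x i)) \<in> borel_measurable M" if "v \<in> R" for v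
    unfolding M_def using g[OF that] by (rule sum_coordinates_measurable)
  have bad: "bad v \<in> sets M" if "v \<in> R" for v
    unfolding bad_def using sum_meas[OF that] by measurable
  have "measure M (\<Union>v\<in>R. bad v) \<le> (\<Sum>v\<in>R. measure M (bad v))"
    using bad \<open>finite R\<close> by (intro M.finite_measure_subadditive_finite) auto
  also have "\<dots> \<le> (\<Sum>v\<in>R. 2 * exp (- 2 * real n * t\<^sup>2 / (b - a)\<^sup>2))"
    unfolding bad_def M_def
    by (intro sum_mono Hoeffding_sample_mean N g ran \<open>a < b\<close> \<open>0 < n\<close> \<open>0 \<le> t\<close>)
  finally have "1 - real (card R) * (2 * exp (- 2 * real n * t\<^sup>2 / (b - a)\<^sup>2)) \<le> measure M (space M - (\<Union>v\<in>R. bad v))"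
    using bad \<open>finite R\<close> by (subst M.prob_compl) auto
  also have "\<dots> \<le> measure M {x\<in>space M. \<forall>v\<in>R. \<bar>(\<Sum>i=1..n. g v (x i)) / n - (\<integral>x. g v x \<partial>N)\<bar> \<le> t}"
  proof (rule M.finite_measure_mono)
    show "{x\<in>space M. \<forall>v\<in>R. \<bar>(\<Sum>i=1..n. g v (x i)) / n - (\<integral>x. g v x \<partial>N)\<bar> \<le> t} \<in> M.events"
      unfolding M_def using g \<open>finite R\<close> by (rule uniform_deviation_event)
  qed (auto simp: bad_def)
  finally show ?thesis .
qed

section \<open>Integrals against probability measures and empirical measures\<close>

lemma (in prob_space) abs_integral_le:
  fixes g :: "'a \<Rightarrow> real"
  assumes "\<And>x. x \<in> space M \<Longrightarrow> \<bar>g x\<bar> \<le> B"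
  shows "\<bar>\<integral>x. g x \<partial>M\<bar> \<le> B"
proof -
  obtain x where "x \<in> space M" using not_empty by blast
  with assms have "0 \<le> B" by (meson abs_ge_zero order_trans)
  \<comment> \<open>A non-integrable \<open>g\<close> has integral 0 by convention, and 0 is within
    the bound as \<open>B\<close> is nonnegative.\<close>
  show ?thesis
  proof (cases "integrable M g")
    case True
    have "\<bar>\<integral>x. g x \<partial>M\<bar> \<le> (\<integral>x. \<bar>g x\<bar> \<partial>M)" by (rule integral_abs_bound)
    also have "\<dots> \<le> (\<integral>x. B \<partial>M)" using True assms by (intro integral_mono) auto
    finally show ?thesis by (simp add: prob_space)
  qed (simp add: not_integrable_integral_eq \<open>0 \<le> B\<close>)
qed

lemma prob_space_empirical:
  assumes "0 < n" "x \<in> {1..n} \<rightarrow> space N"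
  shows "prob_space (empirical N n x)"
  unfolding empirical_def using assms
  by (intro prob_space.prob_space_distr prob_space_uniform_count_measure)
    (auto simp: measurable_cong_sets[OF sets_uniform_count_measure_count_space refl])

lemma integral_empirical:
  fixes g :: "'a \<Rightarrow> real"
  assumes "x \<in> {1..n} \<rightarrow> space N" "g \<in> borel_measurable N"
  shows "(\<integral>y. g y \<partial>empirical N n x) = (\<Sum>i=1..n. g (x i)) / n"
proof -
  have "(\<integral>y. g y \<partial>empirical N n x) = (\<integral>i. g (x i) \<partial>uniform_count_measure {1..n})"
    unfolding empirical_def using assms
    by (intro integral_distr) (auto simp: measurable_cong_sets[OF sets_uniform_count_measure_count_space refl])
  then show ?thesis by (simp add: integral_uniform_count_measure)
qed

subsection \<open>Comparison of F-distances\<close>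

text \<open>The two distances differ only in the integral against the first measure, and a supremum
  moves by at most as much as its terms. The bound \<open>B\<close> makes the supremum on the right
  finite; for empty \<open>F\<close> both suprema are the same default
  \<open>Sup {}\<close>.\<close>

lemma F_distance_diff_le:
  assumes \<mu>': "prob_space \<mu>'" "space \<mu>' = S" and \<nu>: "prob_space \<nu>" "space \<nu> = S"
    and bound: "\<And>f x. f \<in> F \<Longrightarrow> x \<in> S \<Longrightarrow> \<bar>\<phi> (f x)\<bar> \<le> B \<and> \<bar>\<phi> (1 - f x)\<bar> \<le> B"
    and dev: "\<And>f. f \<in> F \<Longrightarrow> (\<integral>x. \<phi> (f x) \<partial>\<mu>) \<le> (\<integral>x. \<phi> (f x) \<partial>\<mu>') + t" and "0 \<le> t"
  shows "F_distance F \<phi> \<mu> \<nu> \<le> F_distance F \<phi> \<mu>' \<nu> + t"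
proof (cases "F = {}")
  case True
  with \<open>0 \<le> t\<close> show ?thesis by (simp add: F_distance_def)
next
  case False
  let ?J = "\<lambda>\<mu> f. (\<integral>x. \<phi> (f x) \<partial>\<mu>) + (\<integral>x. \<phi> (1 - f x) \<partial>\<nu>)"
  have "?J \<mu>' f \<le> B + B" if "f \<in> F" for f
    using prob_space.abs_integral_le[OF \<mu>'(1), of "\<lambda>x. \<phi> (f x)" B]
      prob_space.abs_integral_le[OF \<nu>(1), of "\<lambda>x. \<phi> (1 - f x)" B] bound[OF that] \<mu>' \<nu>
    by fastforce
  then have bdd: "bdd_above (?J \<mu>' ` F)" by (auto intro!: bdd_aboveI2)
  have "(SUP f\<in>F. ?J \<mu> f) \<le> (SUP f\<in>F. ?J \<mu>' f) + t"
  proof (rule cSUP_least[OF False])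
    fix f assume f: "f \<in> F"
    have "?J \<mu>' f \<le> (SUP f\<in>F. ?J \<mu>' f)" by (rule cSUP_upper[OF f bdd])
    with dev[OF f] show "?J \<mu> f \<le> (SUP f\<in>F. ?J \<mu>' f) + t" by linarith
  qed
  then show ?thesis by (simp add: F_distance_def)
qed

text \<open>An infimum of reals is a lower bound only for sets that are bounded below. Any single
  \<open>f\<close> bounds the supremum from below, uniformly in \<nu>.\<close>

lemma F_distance_bdd_below:
  assumes \<mu>: "prob_space \<mu>" "space \<mu> = S" and N: "\<And>\<nu>. \<nu> \<in> N \<Longrightarrow> prob_space \<nu> \<and> space \<nu> = S"
    and bound: "\<And>f x. f \<in> F \<Longrightarrow> x \<in> S \<Longrightarrow> \<bar>\<phi> (f x)\<bar> \<le> B \<and> \<bar>\<phi> (1 - f x)\<bar> \<le> B"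
  shows "bdd_below (F_distance F \<phi> \<mu> ` N)"
proof (cases "F = {}")
  case True
  then show ?thesis
    by (intro bdd_belowI2[of _ "Sup {} - 2 * \<phi> (1 / 2)"]) (simp add: F_distance_def)
next
  case False
  then obtain f where f: "f \<in> F" by blast
  show ?thesis
  proof (rule bdd_belowI2)
    fix \<nu> assume \<nu>: "\<nu> \<in> N"
    let ?J = "\<lambda>f. (\<integral>x. \<phi> (f x) \<partial>\<mu>) + (\<integral>x. \<phi> (1 - f x) \<partial>\<nu>)"
    have J: "\<bar>?J f\<bar> \<le> B + B" if "f \<in> F" for f
      using prob_space.abs_integral_le[OF \<mu>(1), of "\<lambda>x. \<phi> (f x)" B]
        prob_space.abs_integral_le[of \<nu> "\<lambda>x. \<phi> (1 - f x)" B] bound[OF that] \<mu> N[OF \<nu>]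
      by fastforce
    then have bdd: "bdd_above (?J ` F)" by (intro bdd_aboveI2[of _ _ "B + B"]) (meson abs_le_D1)
    have "- (B + B) \<le> ?J f" using J[OF f] by linarith
    also have "\<dots> \<le> (SUP f\<in>F. ?J f)" by (rule cSUP_upper[OF f bdd])
    finally show "- (B + B) - 2 * \<phi> (1 / 2) \<le> F_distance F \<phi> \<mu> \<nu>" by (simp add: F_distance_def)
  qed
qed

text \<open>One \<open>t\<close> is lost in passing from \<open>p a\<close> to \<open>q a\<close>,
  the other in comparing the two infima.\<close>

lemma approximate_minimizer_transfer:
  fixes p q :: "'a \<Rightarrow> real"
  assumes a: "a \<in> N" "q a \<le> (INF b\<in>N. q b) + \<epsilon>" and "bdd_below (q ` N)"
    and pq: "\<And>b. b \<in> N \<Longrightarrow> p b \<le> q b + t" and qp: "\<And>b. b \<in> N \<Longrightarrow> q b \<le> p b + t"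
  shows "p a \<le> (INF b\<in>N. p b) + 2 * t + \<epsilon>"
proof -
  have "(INF b\<in>N. q b) - t \<le> (INF b\<in>N. p b)"
  proof (rule cINF_greatest)
    fix b assume b: "b \<in> N"
    have "(INF b\<in>N. q b) \<le> q b" by (rule cINF_lower[OF \<open>bdd_below _\<close> b])
    with qp[OF b] show "(INF b\<in>N. q b) - t \<le> p b" by linarith
  qed (use a in blast)
  with pq[OF a(1)] a(2) show ?thesis by linarith
qed

lemma lipschitz_on_subunit_bounded:
  fixes \<phi> :: "real \<Rightarrow> real"
  assumes "\<rho>-lipschitz_on {0..1} \<phi>" "s \<in> {0..1}"
  shows "\<bar>\<phi> s\<bar> \<le> \<bar>\<phi> 0\<bar> + \<rho>"
proof -
  have "0 \<le> \<rho>" using assms(1) by (rule lipschitz_on_nonneg)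
  have "\<bar>\<phi> s - \<phi> 0\<bar> \<le> \<rho> * \<bar>s - 0\<bar>"
    using lipschitz_onD[OF assms(1), of s 0] assms(2) by (auto simp: dist_real_def)
  also have "\<dots> \<le> \<rho> * 1" using \<open>0 \<le> \<rho>\<close> assms(2) by (intro mult_left_mono) auto
  finally show ?thesis by linarith
qed

lemma prob_algebra_borel_vecD:
  assumes "\<mu> \<in> space (prob_algebra (borel_vec m))"
  shows "prob_space \<mu>" "sets \<mu> = sets (borel_vec m)" "space \<mu> = carrier_vec m"
proof -
  show *: "prob_space \<mu>" "sets \<mu> = sets (borel_vec m)"
    using assms by (auto simp: space_prob_algebra)
  show "space \<mu> = carrier_vec m"
    using sets_eq_imp_space_eq[OF *(2)] by (simp add: space_borel_vec)
qed

lemma (in prob_space) abs_integral_diff_le: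
  fixes g h :: "'a \<Rightarrow> real"
  assumes "integrable M g" "integrable M h" "AE x in M. \<bar>g x - h x\<bar> \<le> e"
  shows "\<bar>(\<integral>x. g x \<partial>M) - (\<integral>x. h x \<partial>M)\<bar> \<le> e"
proof -
  have "(\<integral>x. g x \<partial>M) - (\<integral>x. h x \<partial>M) = (\<integral>x. g x - h x \<partial>M)"
    using assms by simp
  also have "\<bar>\<dots>\<bar> \<le> (\<integral>x. \<bar>g x - h x\<bar> \<partial>M)"
    by (rule integral_abs_bound)
  also have "\<dots> \<le> (\<integral>x. e \<partial>M)"
    using assms by (intro integral_mono_AE) auto
  finally show ?thesis by (simp add: prob_space)
qed

lemma abs_mean_diff_le:
  fixes g h :: "nat \<Rightarrow> real"
  assumes "0 < n" "\<And>i. i \<in> {1..n} \<Longrightarrow> \<bar>g i - h i\<bar> \<le> e"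
  shows "\<bar>(\<Sum>i=1..n. g i) / n - (\<Sum>i=1..n. h i) / n\<bar> \<le> e"
proof -
  have "\<bar>\<Sum>i=1..n. g i - h i\<bar> \<le> (\<Sum>i=1..n. \<bar>g i - h i\<bar>)" by (rule sum_abs)
  also have "\<dots> \<le> (\<Sum>i=1..n. e)" using assms by (intro sum_mono) auto
  finally have "\<bar>\<Sum>i=1..n. g i - h i\<bar> \<le> n * e" by simp
  then show ?thesis
    using \<open>0 < n\<close>
    by (simp add: pos_divide_le_eq mult.commute sum_subtractf flip: diff_divide_distrib)
qed

subsection \<open>The generalization bound\<close>

text \<open>The grid fineness \<open>K\<close> and the deviation \<open>t\<close> stay free here;
  \<open>tail\<close> is the condition that links them to \<delta>. In the conclusion, the inner
  factor 2 counts the rounding error once for the expectation and once for the sample mean; the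
  outer one comes from \<open>approximate_minimizer_transfer\<close>.\<close>

lemma (in network) generalization:
  fixes F :: "(real Matrix.vec \<Rightarrow> real) set" and \<mu> :: "real Matrix.vec measure"
    and DG :: "real Matrix.vec measure set" and \<nu> :: "(nat \<Rightarrow> real Matrix.vec) \<Rightarrow> real Matrix.vec measure"
  assumes Bx: "0 < Bx" and m: "\<And>k. k \<in> {1..L + 1} \<Longrightarrow> d k \<le> m"
    and A: "range A \<subseteq> {0..1}" "1-lipschitz_on UNIV A" and \<phi>: "\<rho>-lipschitz_on {0..1} \<phi>"
    and F: "F = discriminator_class A \<sigma> L d BW"
    and \<mu>: "\<mu> \<in> space (prob_algebra (borel_vec (d 1)))"
    and DG: "DG \<subseteq> space (prob_algebra (borel_vec (d 1)))"
    and n: "0 < n" and K: "0 < K" and t: "0 \<le> t"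
  defines "\<beta> \<equiv> Bx * (\<Prod>i=1..L. BW i)" and "M \<equiv> \<Pi>\<^sub>M i\<in>{1..n}. \<mu>"
  assumes sample: "AE x in M. \<forall>i\<in>{1..n}. vnorm (x i) \<le> Bx"
    and minimizer: "AE x in M. \<nu> x \<in> DG \<and> F_distance F \<phi> (empirical (borel_vec (d 1)) n x) (\<nu> x)
           \<le> (INF \<nu>'\<in>DG. F_distance F \<phi> (empirical (borel_vec (d 1)) n x) \<nu>') + \<epsilon>"
    and tail: "0 < \<rho> \<Longrightarrow>
      real ((2 * K + 1) ^ (L * m\<^sup>2)) * (2 * exp (- 2 * real n * t\<^sup>2 / (2 * (\<rho> * \<beta>))\<^sup>2)) \<le> \<delta>"
    and "0 \<le> \<delta>"
  shows "with_prob_at_least M (1 - \<delta>) (\<lambda>x. F_distance F \<phi> \<mu> (\<nu> x)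
    \<le> (INF \<nu>'\<in>DG. F_distance F \<phi> \<mu> \<nu>') + 2 * (t + 2 * (\<rho> * (real L * (real m)\<^sup>2 * (1 / real K) * \<beta>))) + \<epsilon>)"
proof -
  note \<mu>_prob = prob_algebra_borel_vecD[OF \<mu>]
  interpret \<mu>: prob_space \<mu> by (rule \<mu>_prob)
  interpret M: prob_space M unfolding M_def by (intro prob_space_PiM \<mu>_prob)
  have space_M: "x \<in> {1..n} \<rightarrow> carrier_vec (d 1)" if "x \<in> space M" for x
    using that \<mu>_prob(3) by (auto simp: M_def space_PiM)
  have \<rho>: "0 \<le> \<rho>" using \<phi> by (rule lipschitz_on_nonneg)
  have A01: "A s \<in> {0..1}" for s using A(1) by blast
  define \<psi> where "\<psi> s = \<phi> (A s)" for s
  have \<psi>_lip: "\<bar>\<psi> s - \<psi> s'\<bar> \<le> \<rho> * \<bar>s - s'\<bar>" for s s'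
  proof -
    have "\<bar>\<psi> s - \<psi> s'\<bar> \<le> \<rho> * \<bar>A s - A s'\<bar>"
      using lipschitz_onD[OF \<phi> A01 A01, of s s'] by (simp add: \<psi>_def dist_real_def)
    also have "\<dots> \<le> \<rho> * \<bar>s - s'\<bar>"
      using lipschitz_onD[OF A(2), of s s'] \<rho> by (intro mult_left_mono) (auto simp: dist_real_def)
    finally show ?thesis .
  qed
  \<comment> \<open>A crude bound that only provides integrability and bounded suprema; it does not
    enter the rate.\<close>
  define B where "B = \<bar>\<phi> 0\<bar> + \<rho>"
  have \<psi>_bound: "\<bar>\<psi> s\<bar> \<le> B" for s
    using lipschitz_on_subunit_bounded[OF \<phi> A01] by (simp add: \<psi>_def B_def)
  define g where "g W x = \<psi> (discriminator \<sigma> L W x)" for W x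
  have [measurable]: "\<psi> \<in> borel_measurable borel"
    using \<psi>_lip \<rho>
    by (intro borel_measurable_continuous_onI lipschitz_on_continuous_on[of \<rho>])
      (auto intro!: lipschitz_onI simp: dist_real_def)
  have g_meas: "g W \<in> borel_measurable (borel_vec (d 1))" if "W \<in> weights" for W
    using discriminator_measurable[OF that] unfolding g_def[abs_def] by measurable
  then have g_meas_\<mu>: "g W \<in> borel_measurable \<mu>" if "W \<in> weights" for W
    using that by (simp add: measurable_cong_sets[OF \<mu>_prob(2) refl])
  have g_int: "integrable \<mu> (g W)" if "W \<in> weights" for W
    using \<psi>_bound by (intro \<mu>.integrable_const_bound[of _ B] g_meas_\<mu> that) (auto simp: g_def)
  have F_bound: "\<bar>\<phi> (f x)\<bar> \<le> B \<and> \<bar>\<phi> (1 - f x)\<bar> \<le> B" if "f \<in> F" "x \<in> carrier_vec (d 1)" for f x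
  proof -
    have "f x \<in> {0..1}" using that A01 by (auto simp: F discriminator_class_eq simp del: atLeastAtMost_iff)
    then show ?thesis
      using lipschitz_on_subunit_bounded[OF \<phi>, of "f x"] lipschitz_on_subunit_bounded[OF \<phi>, of "1 - f x"]
      by (auto simp: B_def)
  qed
  define \<kappa> where "\<kappa> = \<rho> * (real L * (real m)\<^sup>2 * (1 / real K) * \<beta>)"
  have BW_prod: "0 < (\<Prod>i=1..L. BW i)" using BW by (intro prod_pos) auto
  then have \<beta>: "0 < \<beta>" using Bx by (simp add: \<beta>_def)
  have \<kappa>: "0 \<le> \<kappa>" using \<rho> \<beta> by (simp add: \<kappa>_def)
  obtain R where R: "R \<subseteq> weights" "finite R" "card R \<le> (2 * K + 1) ^ (L * m\<^sup>2)"
    and cover: "\<And>W. W \<in> weights \<Longrightarrow> \<exists>V\<in>R. \<forall>i r c. i < L \<longrightarrow> r < d (Suc (Suc i)) \<longrightarrow> c < d (Suc i) \<longrightarrow>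
      \<bar>W (Suc i) $$ (r, c) - V (Suc i) $$ (r, c)\<bar> \<le> 1 / real K * BW (Suc i)"
    using weights_cover[OF K m] by blast
  have net: "\<exists>V\<in>R. \<forall>x\<in>carrier_vec (d 1). vnorm x \<le> Bx \<longrightarrow> \<bar>g W x - g V x\<bar> \<le> \<kappa>"
    if W: "W \<in> weights" for W
  proof -
    from cover[OF W] obtain V where V: "V \<in> R"
      and diff: "\<And>i r c. i < L \<Longrightarrow> r < d (Suc (Suc i)) \<Longrightarrow> c < d (Suc i) \<Longrightarrow>
        \<bar>W (Suc i) $$ (r, c) - V (Suc i) $$ (r, c)\<bar> \<le> 1 / real K * BW (Suc i)" by blast
    have "\<bar>g W x - g V x\<bar> \<le> \<kappa>" if x: "x \<in> carrier_vec (d 1)" "vnorm x \<le> Bx" for x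
    proof -
      have "\<bar>discriminator \<sigma> L W x - discriminator \<sigma> L V x\<bar>
          \<le> real L * (real m)\<^sup>2 * (1 / real K) * (vnorm x * (\<Prod>j=1..L. BW j))"
        using V R(1) by (intro abs_discriminator_diff_le W x m diff) auto
      also have "\<dots> \<le> real L * (real m)\<^sup>2 * (1 / real K) * \<beta>"
        unfolding \<beta>_def using x BW_prod by (intro mult_left_mono mult_right_mono) auto
      finally show ?thesis
        unfolding g_def \<kappa>_def using \<rho> by (intro order_trans[OF \<psi>_lip] mult_left_mono)
    qed
    with V show ?thesis by blast
  qed
  \<comment> \<open>The first coordinate of the sample has law \<mu>, so the almost sure bound on
    the sample passes to \<mu>. Here \<open>0 < n\<close> matters.\<close>
  have sample_\<mu>: "AE x in \<mu>. vnorm x \<le> Bx"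
  proof -
    have 1: "1 \<in> {1..n}" using n by simp
    have "AE x in M. vnorm (x 1) \<le> Bx" using sample by eventually_elim (use 1 in auto)
    then have "AE x in distr M \<mu> (\<lambda>x. x 1). vnorm x \<le> Bx"
    proof (subst AE_distr_iff)
      show "(\<lambda>x. x 1) \<in> M \<rightarrow>\<^sub>M \<mu>" unfolding M_def using 1 by measurable
      have [measurable]: "vnorm \<in> borel_measurable \<mu>"
        using vnorm_measurable by (simp add: measurable_cong_sets[OF \<mu>_prob(2) refl])
      show "{x \<in> space \<mu>. vnorm x \<le> Bx} \<in> sets \<mu>" by measurable
    qed
    moreover have "distr M \<mu> (\<lambda>x. x 1) = \<mu>"
      unfolding M_def by (rule distr_PiM_component) (use 1 \<mu>_prob in auto)
    ultimately show ?thesis by (simp only:)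
  qed
  define good where "good = {x\<in>space M. \<forall>V\<in>R. \<bar>(\<Sum>i=1..n. g V (x i)) / n - (\<integral>x. g V x \<partial>\<mu>)\<bar> \<le> t}"
  have good_meas: "good \<in> M.events"
    unfolding good_def M_def using R g_meas_\<mu> by (intro uniform_deviation_event) auto
  have good_prob: "1 - \<delta> \<le> M.prob good"
  \<comment> \<open>Hoeffding's inequality is applied on an interval of positive length. For
    \<open>\<rho> = 0\<close> every \<open>g V\<close> is constant and nothing deviates.\<close>
  proof (cases "\<rho> = 0")
    case True
    have g_const: "g V = (\<lambda>x. \<psi> 0)" for V
    proof
      fix x
      show "g V x = \<psi> 0" using \<psi>_lip[of "discriminator \<sigma> L V x" 0] True by (simp add: g_def)
    qed
    have "good = space M" using n t by (auto simp: good_def g_const \<mu>.prob_space)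
    then show ?thesis using \<open>0 \<le> \<delta>\<close> by (simp add: M.prob_space)
  next
    case False
    with \<rho> have \<rho>: "0 < \<rho>" by simp
    define r where "r = \<rho> * \<beta>"
    have r: "0 < r" using \<rho> \<beta> by (simp add: r_def)
    \<comment> \<open>\<psi> is \<rho>-Lipschitz and the output is at most \<beta> in absolute
      value, so the values stay within \<open>r\<close> of the value at output 0.\<close>
    have ran: "AE x in \<mu>. g V x \<in> {\<psi> 0 - r..\<psi> 0 + r}" if "V \<in> R" for V
      using sample_\<mu> AE_space
    proof eventually_elim
      case (elim x)
      have "\<bar>discriminator \<sigma> L V x\<bar> \<le> vnorm x * (\<Prod>j=1..L. BW j)"
        using elim \<mu>_prob(3) that R(1) by (intro abs_discriminator_le) auto
      also have "\<dots> \<le> \<beta>"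
        unfolding \<beta>_def using elim BW_prod by (intro mult_right_mono) auto
      finally have "\<rho> * \<bar>discriminator \<sigma> L V x - 0\<bar> \<le> r"
        unfolding r_def using \<rho> by (intro mult_left_mono) auto
      with \<psi>_lip[of "discriminator \<sigma> L V x" 0] have "\<bar>g V x - \<psi> 0\<bar> \<le> r"
        unfolding g_def by linarith
      then show ?case by auto
    qed
    have "real (card R) * (2 * exp (- 2 * real n * t\<^sup>2 / (2 * r)\<^sup>2))
        \<le> real ((2 * K + 1) ^ (L * m\<^sup>2)) * (2 * exp (- 2 * real n * t\<^sup>2 / (2 * r)\<^sup>2))"
      using R(3) by (intro mult_right_mono of_nat_mono) auto
    also have "\<dots> \<le> \<delta>" using tail[OF \<rho>] by (simp add: r_def)
    finally have "1 - \<delta> \<le> 1 - real (card R) * (2 * exp (- 2 * real n * t\<^sup>2 / (2 * r)\<^sup>2))" by simp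
    also have "\<dots> \<le> M.prob good"
      unfolding good_def M_def
      using Hoeffding_sample_mean_uniform[where R = R and g = g, OF \<mu>_prob(1) g_meas_\<mu> ran _ n t R(2)] r R(1)
      by auto
    finally show ?thesis .
  qed
  from sample minimizer have "AE x in M. (\<forall>i\<in>{1..n}. vnorm (x i) \<le> Bx) \<and> \<nu> x \<in> DG \<and>
      F_distance F \<phi> (empirical (borel_vec (d 1)) n x) (\<nu> x)
           \<le> (INF \<nu>'\<in>DG. F_distance F \<phi> (empirical (borel_vec (d 1)) n x) \<nu>') + \<epsilon>" (is "AE x in M. ?P x")
    by eventually_elim simp
  \<comment> \<open>The almost sure hypotheses fail only inside the null set \<open>Z\<close>.
    Removing it costs no probability, and \<open>good - Z\<close> is a measurable event even though
    \<nu> may depend on the sample arbitrarily.\<close>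
  then obtain Z where Z: "\<And>x. x \<in> space M - Z \<Longrightarrow> ?P x" "Z \<in> null_sets M"
    by (rule AE_E3) (rule that)
  have "F_distance F \<phi> \<mu> (\<nu> x) \<le> (INF \<nu>'\<in>DG. F_distance F \<phi> \<mu> \<nu>') + 2 * (t + 2 * \<kappa>) + \<epsilon>"
    if x: "x \<in> good" "x \<notin> Z" for x
  proof -
    let ?E = "empirical (borel_vec (d 1)) n x"
    have x_space: "x \<in> space M" using x by (simp add: good_def)
    have P: "?P x" using x_space x(2) by (intro Z(1)) auto
    have E: "prob_space ?E" "space ?E = carrier_vec (d 1)"
      using prob_space_empirical[OF n, of x "borel_vec (d 1)"] space_M[OF x_space]
      by (auto simp: space_borel_vec empirical_def)
    \<comment> \<open>Going from \<open>W\<close> to its representative \<open>V\<close> under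
      \<mu>, from expectation to sample mean for \<open>V\<close>, and back to \<open>W\<close> in
      the sample costs \<kappa>, \<open>t\<close> and \<kappa>.\<close>
    have dev: "\<bar>(\<integral>y. \<phi> (f y) \<partial>\<mu>) - (\<integral>y. \<phi> (f y) \<partial>?E)\<bar> \<le> t + 2 * \<kappa>" if f: "f \<in> F" for f
    proof -
      from f obtain W where W: "W \<in> weights"
        and f_eq: "f = (\<lambda>x\<in>carrier_vec (d 1). A (discriminator \<sigma> L W x))"
        by (auto simp: F discriminator_class_eq)
      obtain V where V: "V \<in> R"
        and VW: "\<And>y. y \<in> carrier_vec (d 1) \<Longrightarrow> vnorm y \<le> Bx \<Longrightarrow> \<bar>g W y - g V y\<bar> \<le> \<kappa>"
        using net[OF W] by blast
      have "(\<integral>y. \<phi> (f y) \<partial>\<mu>) = (\<integral>y. g W y \<partial>\<mu>)"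
        using \<mu>_prob(3) by (intro Bochner_Integration.integral_cong) (auto simp: f_eq g_def \<psi>_def)
      moreover have "(\<integral>y. \<phi> (f y) \<partial>?E) = (\<Sum>i=1..n. g W (x i)) / n"
      proof -
        have "(\<integral>y. \<phi> (f y) \<partial>?E) = (\<integral>y. g W y \<partial>?E)"
          using E(2) by (intro Bochner_Integration.integral_cong) (auto simp: f_eq g_def \<psi>_def)
        then show ?thesis
          using integral_empirical[OF _ g_meas[OF W], of x n] space_M[OF x_space]
          by (simp add: space_borel_vec)
      qed
      moreover have "\<bar>(\<integral>y. g W y \<partial>\<mu>) - (\<integral>y. g V y \<partial>\<mu>)\<bar> \<le> \<kappa>"
      proof (rule \<mu>.abs_integral_diff_le)
        show "AE y in \<mu>. \<bar>g W y - g V y\<bar> \<le> \<kappa>"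
          using sample_\<mu> AE_space by eventually_elim (use VW \<mu>_prob(3) in auto)
      qed (use W V R(1) g_int in auto)
      moreover have "\<bar>(\<Sum>i=1..n. g W (x i)) / n - (\<Sum>i=1..n. g V (x i)) / n\<bar> \<le> \<kappa>"
      proof (rule abs_mean_diff_le[OF n])
        fix i assume i: "i \<in> {1..n}"
        then have "x i \<in> carrier_vec (d 1)" using space_M[OF x_space] by blast
        with i P show "\<bar>g W (x i) - g V (x i)\<bar> \<le> \<kappa>" by (intro VW) auto
      qed
      moreover have "\<bar>(\<Sum>i=1..n. g V (x i)) / n - (\<integral>y. g V y \<partial>\<mu>)\<bar> \<le> t"
        using x(1) V by (simp add: good_def)
      ultimately show ?thesis by linarith
    qed
    have DG_prob: "prob_space \<nu>' \<and> space \<nu>' = carrier_vec (d 1)" if "\<nu>' \<in> DG" for \<nu>'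
      using prob_algebra_borel_vecD[of \<nu>'] that DG by auto
    show ?thesis
    proof (rule approximate_minimizer_transfer)
      show "\<nu> x \<in> DG" using P by simp
      show "F_distance F \<phi> ?E (\<nu> x) \<le> (INF \<nu>'\<in>DG. F_distance F \<phi> ?E \<nu>') + \<epsilon>" using P by simp
      show "bdd_below (F_distance F \<phi> ?E ` DG)"
        by (rule F_distance_bdd_below[where B = B, OF E]) (fact DG_prob F_bound)+
      fix \<nu>' assume "\<nu>' \<in> DG"
      note \<nu>' = DG_prob[OF this, THEN conjunct1] DG_prob[OF this, THEN conjunct2]
      show "F_distance F \<phi> \<mu> \<nu>' \<le> F_distance F \<phi> ?E \<nu>' + (t + 2 * \<kappa>)"
      proof (rule F_distance_diff_le[where B = B, OF E \<nu>'])
        show "\<bar>\<phi> (f x)\<bar> \<le> B \<and> \<bar>\<phi> (1 - f x)\<bar> \<le> B" if "f \<in> F" "x \<in> carrier_vec (d 1)" for f x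
          using that by (rule F_bound)
        show "(\<integral>y. \<phi> (f y) \<partial>\<mu>) \<le> (\<integral>y. \<phi> (f y) \<partial>?E) + (t + 2 * \<kappa>)" if "f \<in> F" for f
          using dev[OF that] by linarith
      qed (use t \<kappa> in simp)
      show "F_distance F \<phi> ?E \<nu>' \<le> F_distance F \<phi> \<mu> \<nu>' + (t + 2 * \<kappa>)"
      proof (rule F_distance_diff_le[where B = B, OF \<mu>_prob(1,3) \<nu>'])
        show "\<bar>\<phi> (f x)\<bar> \<le> B \<and> \<bar>\<phi> (1 - f x)\<bar> \<le> B" if "f \<in> F" "x \<in> carrier_vec (d 1)" for f x
          using that by (rule F_bound)
        show "(\<integral>y. \<phi> (f y) \<partial>?E) \<le> (\<integral>y. \<phi> (f y) \<partial>\<mu>) + (t + 2 * \<kappa>)" if "f \<in> F" for f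
          using dev[OF that] by linarith
      qed (use t \<kappa> in simp)
    qed
  qed
  moreover have "M.prob (good - Z) = M.prob good"
    using Z(2) good_meas by (simp add: measure_Diff_null_set)
  ultimately show ?thesis
    unfolding with_prob_at_least_def \<kappa>_def[symmetric]
    using good_prob good_meas Z(2) by (intro bexI[of _ "good - Z"]) auto
qed

section \<open>Numerical estimates for covering number, tail and rate\<close>

lemma log_covering_number_le:
  fixes L m n :: nat
  assumes "1 \<le> L" "1 \<le> m" "3 \<le> n" "L * m\<^sup>2 \<le> n" and \<beta>: "0 < \<beta>" "1 \<le> real n * \<beta> ^ 4"
  defines "l \<equiv> ln (sqrt (real m * real n) * real L * \<beta>)"
  shows "1 \<le> 4 * l" "ln (real (2 * (L * m\<^sup>2 * n) + 1)) \<le> 12 * l"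
proof -
  have n: "0 < real n" using assms(3) by simp
  have "0 \<le> ln (real n * \<beta> ^ 4)" using \<beta> by simp
  also have "\<dots> = ln n + 4 * ln \<beta>" using \<beta> n by (simp add: ln_mult ln_realpow)
  finally have *: "0 \<le> ln n + 4 * ln \<beta>" .
  \<comment> \<open>By \<open>*\<close>, 2 ln \<beta> is at least - (ln n) / 2, so half of ln n
    survives in 2 l even for small \<beta>.\<close>
  have "2 * l = ln m + ln n + 2 * ln L + 2 * ln \<beta>"
    using assms n by (simp add: l_def ln_mult ln_sqrt)
  moreover have "0 \<le> ln (real m)" "0 \<le> ln (real L)" using assms by auto
  ultimately have l: "ln n \<le> 4 * l" using * by linarith
  have "exp 1 \<le> real n" using exp_le assms(3) by linarith
  then have "ln (exp 1) \<le> ln (real n)" using n by (subst ln_le_cancel_iff) auto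
  with l show "1 \<le> 4 * l" by simp
  \<comment> \<open>Of the three factors n in the bound, one absorbs the constant 3, one absorbs L
    m^2, and one is already present.\<close>
  have "2 * (L * m\<^sup>2 * n) + 1 \<le> 3 * (L * m\<^sup>2 * n)" using assms by simp
  also have "\<dots> \<le> n * (n * n)" using assms by (intro mult_mono) auto
  finally have "real (2 * (L * m\<^sup>2 * n) + 1) \<le> real (n ^ 3)"
    by (intro of_nat_mono) (simp add: power3_eq_cube)
  then have "ln (real (2 * (L * m\<^sup>2 * n) + 1)) \<le> ln (real n ^ 3)"
    by (subst ln_le_cancel_iff) (use n in \<open>auto intro: add_pos_nonneg\<close>)
  also have "\<dots> = 3 * ln n" using n by (simp add: ln_realpow)
  finally show "ln (real (2 * (L * m\<^sup>2 * n) + 1)) \<le> 12 * l" using l by linarith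
qed

text \<open>The constant 6 in \<open>t\<close> makes the exponent -18 (s + u)^2, where s and u are
  the two square roots. Of at least 18 s^2 + 18 u^2, the covering number consumes 12 s^2 and the
  factor 2 of the two-sided inequality 4 s^2, since s^2 is at least 1/4; u^2 of the rest yields
  \<delta>.\<close>

lemma Hoeffding_tail_le:
  fixes L m n :: nat
  assumes "1 \<le> L" "1 \<le> m" "3 \<le> n" "L * m\<^sup>2 \<le> n" and \<beta>: "0 < \<beta>" "1 \<le> real n * \<beta> ^ 4"
    and "0 < \<rho>" and \<delta>: "0 < \<delta>" "\<delta> < 1"
  defines "l \<equiv> ln (sqrt (real m * real n) * real L * \<beta>)"
  defines "t \<equiv> 6 * (\<rho> * \<beta>) * (sqrt (real (L * m\<^sup>2) * l) + sqrt (ln (1 / \<delta>))) / sqrt n"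
  shows "real ((2 * (L * m\<^sup>2 * n) + 1) ^ (L * m\<^sup>2)) * (2 * exp (- 2 * real n * t\<^sup>2 / (2 * (\<rho> * \<beta>))\<^sup>2)) \<le> \<delta>"
proof -
  define P where "P = L * m\<^sup>2"
  define s where "s = sqrt (real P * l)"
  define u where "u = sqrt (ln (1 / \<delta>))"
  have "1 \<le> P" using assms by (simp add: P_def Suc_le_eq)
  have l: "1 \<le> 4 * l" "ln (real (2 * (P * n) + 1)) \<le> 12 * l"
    using log_covering_number_le[OF assms(1-6)] by (simp_all add: l_def P_def)
  have s: "s\<^sup>2 = real P * l" "0 \<le> s" using l by (simp_all add: s_def)
  have u: "u\<^sup>2 = ln (1 / \<delta>)" "0 \<le> u" using \<delta> by (simp_all add: u_def)
  have "1 * (1 / 4) \<le> real P * l" using l \<open>1 \<le> P\<close> by (intro mult_mono) auto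
  then have s_ge: "1 \<le> 4 * s\<^sup>2" using s by simp
  have "- 2 * real n * t\<^sup>2 / (2 * (\<rho> * \<beta>))\<^sup>2 = - 18 * (s + u)\<^sup>2"
  proof -
    have "t\<^sup>2 = 36 * (\<rho> * \<beta>)\<^sup>2 * (s + u)\<^sup>2 / real n"
      by (simp add: t_def s_def u_def P_def power_mult_distrib power_divide)
    then show ?thesis using assms by (simp add: power_mult_distrib)
  qed
  moreover have "real ((2 * (P * n) + 1) ^ P) = exp (real P * ln (real (2 * (P * n) + 1)))"
  proof -
    have "real ((2 * (P * n) + 1) ^ P) = exp (ln (real (2 * (P * n) + 1))) ^ P"
      by (subst exp_ln) (auto intro: add_pos_nonneg)
    then show ?thesis by (simp add: exp_of_nat_mult)
  qed
  moreover have "2 \<le> exp (4 * s\<^sup>2)" using exp_ge_add_one_self[of "4 * s\<^sup>2"] s_ge by linarith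
  ultimately have "real ((2 * (P * n) + 1) ^ P) * (2 * exp (- 2 * real n * t\<^sup>2 / (2 * (\<rho> * \<beta>))\<^sup>2))
      \<le> exp (real P * ln (real (2 * (P * n) + 1))) * (exp (4 * s\<^sup>2) * exp (- 18 * (s + u)\<^sup>2))"
    by (simp add: mult_left_mono mult_right_mono)
  also have "\<dots> = exp (real P * ln (real (2 * (P * n) + 1)) + 4 * s\<^sup>2 - 18 * (s + u)\<^sup>2)"
    by (simp add: exp_add exp_diff exp_minus divide_inverse)
  also have "\<dots> \<le> exp (- u\<^sup>2)"
  proof -
    have "real P * ln (real (2 * (P * n) + 1)) \<le> real P * (12 * l)"
      using l(2) by (intro mult_left_mono) auto
    also have "\<dots> = 12 * s\<^sup>2" using s by simp
    finally have "real P * ln (real (2 * (P * n) + 1)) \<le> 12 * s\<^sup>2" .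
    moreover have "s\<^sup>2 + u\<^sup>2 \<le> (s + u)\<^sup>2" using s u by (simp add: power2_sum)
    moreover have "0 \<le> s\<^sup>2" "0 \<le> u\<^sup>2" by simp_all
    ultimately have "real P * ln (real (2 * (P * n) + 1)) + 4 * s\<^sup>2 - 18 * (s + u)\<^sup>2 \<le> - u\<^sup>2" by linarith
    then show ?thesis by simp
  qed
  also have "exp (- u\<^sup>2) = \<delta>" using u \<delta> by (simp add: ln_div)
  finally show ?thesis by (simp add: P_def)
qed

text \<open>With K = L m^2 n the rounding error is \<rho> \<beta> / n, hence at most r = \<rho>
  \<beta> / sqrt n, and so at most 2 r s because s is at least 1/2. The left side is then at most 2
  (6 r s + 6 r u + 4 r s), which explains the constant 20.\<close>

lemma generalization_rate_le:
  fixes L m n :: nat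
  assumes "1 \<le> L" "1 \<le> m" "3 \<le> n" "L * m\<^sup>2 \<le> n" and \<beta>: "0 < \<beta>" "1 \<le> real n * \<beta> ^ 4"
    and "0 \<le> \<rho>" and "0 \<le> u"
  defines "l \<equiv> ln (sqrt (real m * real n) * real L * \<beta>)"
  defines "s \<equiv> sqrt (real (L * m\<^sup>2) * l)"
  shows "2 * (6 * (\<rho> * \<beta>) * (s + u) / sqrt n
      + 2 * (\<rho> * (real L * (real m)\<^sup>2 * (1 / real (L * m\<^sup>2 * n)) * \<beta>)))
    \<le> 20 * (\<rho> * \<beta> * s / sqrt n + \<rho> * \<beta> * (u / sqrt n))"
proof -
  define r where "r = \<rho> * \<beta> / sqrt n"
  have r: "0 \<le> r" using assms by (simp add: r_def)
  have "1 \<le> L * m\<^sup>2" using assms by (simp add: Suc_le_eq)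
  then have "1 \<le> real (L * m\<^sup>2)" by linarith
  moreover have "1 \<le> 4 * l"
    using log_covering_number_le(1)[OF assms(1-6)] by (simp add: l_def)
  ultimately have "1 * (1 / 4) \<le> real (L * m\<^sup>2) * l" by (intro mult_mono) auto
  then have "sqrt ((1 / 2)\<^sup>2) \<le> s" unfolding s_def by (intro real_sqrt_le_mono) (simp add: power2_eq_square)
  then have s: "1 / 2 \<le> s" by simp
  have "real L * (real m)\<^sup>2 * (1 / real (L * m\<^sup>2 * n)) * \<beta> = \<beta> / n"
    using assms by (simp add: field_simps)
  also have "\<rho> * (\<beta> / n) \<le> r"
  proof -
    have "sqrt n \<le> n" using assms(3) by (intro real_le_lsqrt) (auto simp: power2_eq_square)
    then have "\<rho> * \<beta> / n \<le> \<rho> * \<beta> / sqrt n" using assms by (intro divide_left_mono) auto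
    then show ?thesis by (simp add: r_def)
  qed
  also have "r = r * 1" by simp
  also have "\<dots> \<le> r * (2 * s)" using s r by (intro mult_left_mono) auto
  finally have 1: "\<rho> * (real L * (real m)\<^sup>2 * (1 / real (L * m\<^sup>2 * n)) * \<beta>) \<le> 2 * (r * s)" (is "?X \<le> _")
    by (simp only: mult_ac)
  have 2: "6 * (\<rho> * \<beta>) * (s + u) / sqrt n = 6 * (r * s) + 6 * (r * u)"
    by (simp add: r_def algebra_simps add_divide_distrib)
  have 3: "20 * (\<rho> * \<beta> * s / sqrt n + \<rho> * \<beta> * (u / sqrt n)) = 20 * (r * s) + 20 * (r * u)"
    by (simp add: r_def algebra_simps)
  have "0 \<le> r * u" using r \<open>0 \<le> u\<close> by simp
  moreover have "2 * (6 * y + 6 * z + 2 * x) \<le> 20 * y + 20 * z" if "x \<le> 2 * y" "0 \<le> z" for x y z :: real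
    using that by simp
  ultimately show ?thesis unfolding 2 3 using 1 by blast
qed

theorem theorem3p3:
  "\<exists>C>0::real. \<exists>n\<^sub>0 :: nat \<Rightarrow> nat \<Rightarrow> real \<Rightarrow> nat.
    \<forall>(L::nat) (d :: nat \<Rightarrow> nat) (Bx::real) (BW :: nat \<Rightarrow> real) (dmax::nat) (\<beta>::real) (n::nat)
      (\<sigma> :: nat \<Rightarrow> real Matrix.vec \<Rightarrow> real Matrix.vec) (A :: real \<Rightarrow> real) (\<phi> :: real \<Rightarrow> real) (\<rho>::real)
      (F :: (real Matrix.vec \<Rightarrow> real) set)
      (\<mu> :: real Matrix.vec measure) (DG :: real Matrix.vec measure set) (\<epsilon>::real)
      (\<nu> :: (nat \<Rightarrow> real Matrix.vec) \<Rightarrow> real Matrix.vec measure).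
      1 \<le> L \<and> (\<forall>i\<in>{1..L}. 1 \<le> d i) \<and> d (L + 1) = 1 \<and>
      0 < Bx \<and> (\<forall>i\<in>{1..L}. 0 < BW i) \<and>
      dmax = Max (d ` {1..L}) \<and> \<beta> = Bx * (\<Prod>i=1..L. BW i) \<and>
      n\<^sub>0 dmax L \<beta> \<le> n \<and>
      (\<forall>i\<in>{1..<L}. activation (d (i + 1)) (\<sigma> i)) \<and>
      range A \<subseteq> {0..1} \<and> 1-lipschitz_on UNIV A \<and>
      concave_on {0..1} \<phi> \<and> \<rho>-lipschitz_on {0..1} \<phi> \<and>
      F = discriminator_class A \<sigma> L d BW \<and>
      closed_under_complement (carrier_vec (d 1)) F \<and>
      \<mu> \<in> space (prob_algebra (borel_vec (d 1))) \<and>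
      (AE x in \<Pi>\<^sub>M i\<in>{1..n}. \<mu>. \<forall>i\<in>{1..n}. vnorm (x i) \<le> Bx) \<and>
      DG \<noteq> {} \<and> DG \<subseteq> space (prob_algebra (borel_vec (d 1))) \<and>
      0 \<le> \<epsilon> \<and>
      (AE x in \<Pi>\<^sub>M i\<in>{1..n}. \<mu>. \<nu> x \<in> DG \<and>
         F_distance F \<phi> (empirical (borel_vec (d 1)) n x) (\<nu> x)
           \<le> (INF \<nu>'\<in>DG. F_distance F \<phi> (empirical (borel_vec (d 1)) n x) \<nu>') + \<epsilon>)
      \<longrightarrow>
      (\<forall>\<delta>\<in>{0<..<1}. with_prob_at_least (\<Pi>\<^sub>M i\<in>{1..n}. \<mu>) (1 - \<delta>) (\<lambda>x.
         F_distance F \<phi> \<mu> (\<nu> x)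
           \<le> (INF \<nu>'\<in>DG. F_distance F \<phi> \<mu> \<nu>')
             + C * (\<rho> * \<beta> * sqrt (dmax\<^sup>2 * L * ln (sqrt (dmax * n) * L * \<beta>)) / sqrt n
                    + \<rho> * \<beta> * sqrt (ln (1 / \<delta>) / n))
             + \<epsilon>))"
proof -
  \<comment> \<open>The condition \<open>n \<beta>\<^sup>4 \<ge> 1\<close> gives \<open>ln n \<le> 4 ln (sqrt (m n) L \<beta>)\<close>, so the logarithm in the
    rate dominates the log covering number up to a constant.\<close>
  define n\<^sub>0 :: "nat \<Rightarrow> nat \<Rightarrow> real \<Rightarrow> nat"
    where "n\<^sub>0 m L \<beta> = max (max 3 (L * m\<^sup>2)) (nat \<lceil>1 / \<beta> ^ 4\<rceil>)" for m L \<beta>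
  show ?thesis
  \<comment> \<open>The witness 20 is the constant of \<open>generalization_rate_le\<close>.\<close>
  proof (rule exI[of _ 20], rule conjI, simp, rule exI[of _ n\<^sub>0], intro allI impI ballI, elim conjE)
    fix L :: nat and d :: "nat \<Rightarrow> nat" and Bx :: real and BW :: "nat \<Rightarrow> real" and m :: nat
      and \<beta> :: real and n :: nat and \<sigma> :: "nat \<Rightarrow> real Matrix.vec \<Rightarrow> real Matrix.vec"
      and A \<phi> :: "real \<Rightarrow> real" and \<rho> :: real and F :: "(real Matrix.vec \<Rightarrow> real) set"
      and \<mu> :: "real Matrix.vec measure" and DG :: "real Matrix.vec measure set" and \<epsilon> :: real
      and \<nu> :: "(nat \<Rightarrow> real Matrix.vec) \<Rightarrow> real Matrix.vec measure" and \<delta> :: real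
    assume L: "1 \<le> L" and widths: "\<forall>i\<in>{1..L}. 1 \<le> d i" "d (L + 1) = 1"
      and Bx: "0 < Bx" and BW: "\<forall>i\<in>{1..L}. 0 < BW i"
      and m: "m = Max (d ` {1..L})" and \<beta>: "\<beta> = Bx * (\<Prod>i=1..L. BW i)" and n: "n\<^sub>0 m L \<beta> \<le> n"
      and \<sigma>: "\<forall>i\<in>{1..<L}. activation (d (i + 1)) (\<sigma> i)"
      and A: "range A \<subseteq> {0..1}" "1-lipschitz_on UNIV A" and \<phi>: "\<rho>-lipschitz_on {0..1} \<phi>"
      and F: "F = discriminator_class A \<sigma> L d BW"
      and \<mu>: "\<mu> \<in> space (prob_algebra (borel_vec (d 1)))"
      and DG: "DG \<subseteq> space (prob_algebra (borel_vec (d 1)))"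
      and sample: "AE x in \<Pi>\<^sub>M i\<in>{1..n}. \<mu>. \<forall>i\<in>{1..n}. vnorm (x i) \<le> Bx"
      and minimizer: "AE x in \<Pi>\<^sub>M i\<in>{1..n}. \<mu>. \<nu> x \<in> DG \<and>
         F_distance F \<phi> (empirical (borel_vec (d 1)) n x) (\<nu> x)
           \<le> (INF \<nu>'\<in>DG. F_distance F \<phi> (empirical (borel_vec (d 1)) n x) \<nu>') + \<epsilon>"
      and \<delta>: "\<delta> \<in> {0<..<1}"
    interpret network L d BW \<sigma>
      using L widths BW \<sigma> by unfold_locales auto
    have d_le: "d k \<le> m" if "k \<in> {1..L}" for k
      unfolding m using that by (intro Max_ge) auto
    have m_ge: "1 \<le> m" using d_le[of 1] d[of 1] L by simp
    \<comment> \<open>\<open>m\<close> is the maximum over layers 1 to \<open>L\<close> only; the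
      output width 1 is covered because \<open>1 \<le> m\<close>.\<close>
    have m_bound: "d k \<le> m" if "k \<in> {1..L + 1}" for k
      using that d_le[of k] d_last m_ge by (cases "k = L + 1") auto
    have "0 < (\<Prod>i=1..L. BW i)" using BW by (intro prod_pos) auto
    with Bx have \<beta>_pos: "0 < \<beta>" by (simp add: \<beta>)
    have n_ge: "3 \<le> n" "L * m\<^sup>2 \<le> n" and "nat \<lceil>1 / \<beta> ^ 4\<rceil> \<le> n"
      using n by (auto simp: n\<^sub>0_def)
    then have "1 / \<beta> ^ 4 \<le> real n" by linarith
    then have n\<beta>: "1 \<le> real n * \<beta> ^ 4" using \<beta>_pos by (simp add: pos_divide_le_eq)
    note size = L m_ge n_ge \<beta>_pos n\<beta>
    define s where "s = sqrt (real (L * m\<^sup>2) * ln (sqrt (real m * real n) * real L * \<beta>))"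
    define u where "u = sqrt (ln (1 / \<delta>))"
    define t where "t = 6 * (\<rho> * \<beta>) * (s + u) / sqrt n"
    have \<rho>: "0 \<le> \<rho>" using \<phi> by (rule lipschitz_on_nonneg)
    have l: "0 \<le> ln (sqrt (real m * real n) * real L * \<beta>)"
      using log_covering_number_le(1)[OF size] by simp
    have u: "0 \<le> u" using \<delta> by (simp add: u_def)
    have "0 \<le> s" using l by (simp add: s_def)
    with u \<rho> \<beta>_pos have t: "0 \<le> t" by (simp add: t_def)
    have K: "0 < L * m\<^sup>2 * n" using size by simp
    have n_pos: "0 < n" using n_ge by simp
    \<comment> \<open>The grid parameter is \<open>L * m\<^sup>2 * n\<close>: its first two factors
      cancel those of the perturbation bound, so rounding changes the output by at most \<beta> /
      n.\<close>
    have "with_prob_at_least (\<Pi>\<^sub>M i\<in>{1..n}. \<mu>) (1 - \<delta>) (\<lambda>x. F_distance F \<phi> \<mu> (\<nu> x)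
      \<le> (INF \<nu>'\<in>DG. F_distance F \<phi> \<mu> \<nu>')
        + 2 * (t + 2 * (\<rho> * (real L * (real m)\<^sup>2 * (1 / real (L * m\<^sup>2 * n)) * \<beta>))) + \<epsilon>)"
    proof (rule generalization[OF Bx m_bound A \<phi> F \<mu> DG n_pos K t sample minimizer, folded \<beta>])
      assume "0 < \<rho>"
      then show "real ((2 * (L * m\<^sup>2 * n) + 1) ^ (L * m\<^sup>2))
          * (2 * exp (- 2 * real n * t\<^sup>2 / (2 * (\<rho> * \<beta>))\<^sup>2)) \<le> \<delta>"
        unfolding t_def s_def u_def using \<delta> by (intro Hoeffding_tail_le size) auto
    qed (use \<delta> in auto)
    moreover have "2 * (t + 2 * (\<rho> * (real L * (real m)\<^sup>2 * (1 / real (L * m\<^sup>2 * n)) * \<beta>)))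
      \<le> 20 * (\<rho> * \<beta> * s / sqrt n + \<rho> * \<beta> * (u / sqrt n))"
      unfolding t_def s_def by (rule generalization_rate_le[OF size \<rho> u])
    moreover have "20 * (\<rho> * \<beta> * s / sqrt n + \<rho> * \<beta> * (u / sqrt n))
      = 20 * (\<rho> * \<beta> * sqrt (m\<^sup>2 * L * ln (sqrt (m * n) * L * \<beta>)) / sqrt n
              + \<rho> * \<beta> * sqrt (ln (1 / \<delta>) / n))"
      by (simp add: s_def u_def real_sqrt_divide mult_ac)
    ultimately show "with_prob_at_least (\<Pi>\<^sub>M i\<in>{1..n}. \<mu>) (1 - \<delta>) (\<lambda>x.
         F_distance F \<phi> \<mu> (\<nu> x)
           \<le> (INF \<nu>'\<in>DG. F_distance F \<phi> \<mu> \<nu>')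
             + 20 * (\<rho> * \<beta> * sqrt (m\<^sup>2 * L * ln (sqrt (m * n) * L * \<beta>)) / sqrt n
                    + \<rho> * \<beta> * sqrt (ln (1 / \<delta>) / n))
             + \<epsilon>)"
      \<comment> \<open>The same event serves; only the bound on it is enlarged.\<close>
      unfolding with_prob_at_least_def by (elim bexE conjE, intro bexI conjI ballI) (assumption | force)+
  qed
qed

end
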